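(* Let $q$ be a power of a prime number. The ergodic $\mathscr G_\infty$-invariant probability measures on $\mathrm{Gr}(V_\infty)$ are parameterised bijectively by $\varkappa\in\{0,1,2,\dots\}\cup\{\infty\}$. For $\varkappa=0$ the measure is the Dirac mass at $V_\infty$; for $\varkappa=\infty$ it is the Dirac mass at $V_0=\{0\}$; and for $0<\varkappa<\infty$ the measure is supported by the set of subspaces of $V_\infty$ of codimension $\varkappa$ (that is, this set has full measure).
   Context: Let $\mathbb F_q$ be the field with $q$ elements. $V_n$ is the $n$-dimensional space of sequences $(\xi_1,\xi_2,\dots)$ with entries in $\mathbb F_q$ such that $\xi_i=0$ for $i>n$, and $V_\infty:=\bigcup_{n\ge0}V_n$. $\mathrm{Gr}(V_n)$ and $\mathrm{Gr}(V_\infty)$ denote the sets of all vector subspaces of $V_n$ and of $V_\infty$. $\mathrm{Gr}(V_\infty)$ is endowed with the compact, totally disconnected topology in which a fundamental system of neighbourhoods of $X$ consists of the sets $\{X'\in\mathrm{Gr}(V_\infty): X'\cap V_n=X\cap V_n\}$, $n=1,2,\dots$; measures are Borel with respect to this topology. $\mathscr G_n=GL(n,\mathbb F_q)$ is realised as the group of invertible linear transformations of $V_\infty$ that act on the first $n$ coordinates and leave the remaining coordinates unchanged, and $\mathscr G_\infty:=\bigcup_n\mathscr G_n$; it acts on $V_\infty$ and hence on $\mathrm{Gr}(V_\infty)$. An invariant probability measure is ergodic if every $\mathscr G_\infty$-invariant Borel set has measure $0$ or $1$ (equivalently, it is an extreme point of the convex set of invariant probability measures). *)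

theory Defs
  imports "HOL-Probability.Probability" "HOL-Library.Poly_Mapping" "HOL-Library.Extended_Nat"
begin

(* V_infinity is the type of finitely supported sequences over a finite field 'a (so q = CARD('a),
   which is automatically a prime power); hence V_infinity as a set is UNIV.
   Coordinates are indexed from 0. *)
type_synonym 'a Vinf = "nat \<Rightarrow>\<^sub>0 'a"

definition scale :: "'a::field \<Rightarrow> 'a Vinf \<Rightarrow> 'a Vinf" where
  "scale c \<xi> = Poly_Mapping.map ((*) c) \<xi>"

lemma lookup_scale [simp]: "Poly_Mapping.lookup (scale c \<xi>) i = c * Poly_Mapping.lookup \<xi> i"
  by (simp add: scale_def Poly_Mapping.map.rep_eq when_def)

global_interpretation Vinf: vector_space "scale :: 'a::field \<Rightarrow> 'a Vinf \<Rightarrow> 'a Vinf"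
  by unfold_locales (simp_all add: poly_mapping_eq_iff fun_eq_iff lookup_add algebra_simps)

definition V :: "nat \<Rightarrow> 'a::field Vinf set" where
  "V n = {\<xi>. \<forall>i\<ge>n. Poly_Mapping.lookup \<xi> i = 0}"

definition Gr :: "'a::field Vinf set set" where
  "Gr = {X. Vinf.subspace X}"

definition Gr_nbhd :: "nat \<Rightarrow> 'a::field Vinf set \<Rightarrow> 'a Vinf set set" where
  "Gr_nbhd n X = {X' \<in> Gr. X' \<inter> V n = X \<inter> V n}"

definition Gr_topology :: "'a::field Vinf set topology" where
  "Gr_topology = topology (\<lambda>U. U \<subseteq> Gr \<and> (\<forall>X\<in>U. \<exists>n\<ge>1. Gr_nbhd n X \<subseteq> U))"

lemma V_mono: "m \<le> n \<Longrightarrow> V m \<subseteq> V n"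
  by (auto simp: V_def)

lemma Gr_nbhd_antimono:
  assumes "m \<le> n"
  shows "Gr_nbhd n X \<subseteq> Gr_nbhd m X"
  using V_mono[OF assms] unfolding Gr_nbhd_def by blast

lemma openin_Gr_topology:
  "openin Gr_topology U \<longleftrightarrow> U \<subseteq> Gr \<and> (\<forall>X\<in>U. \<exists>n\<ge>1. Gr_nbhd n X \<subseteq> U)"
proof -
  let ?P = "\<lambda>U :: 'a Vinf set set. U \<subseteq> Gr \<and> (\<forall>X\<in>U. \<exists>n\<ge>1. Gr_nbhd n X \<subseteq> U)"
  have "?P (S \<inter> T)" if S: "?P S" and T: "?P T" for S T
  proof (intro conjI ballI)
    show "S \<inter> T \<subseteq> Gr" using S by blast
    fix X assume X: "X \<in> S \<inter> T"
    obtain m n where "m \<ge> 1" "Gr_nbhd m X \<subseteq> S" "Gr_nbhd n X \<subseteq> T"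
      using S T X by blast
    then have "max m n \<ge> 1" "Gr_nbhd (max m n) X \<subseteq> S \<inter> T"
      using Gr_nbhd_antimono[of m "max m n" X] Gr_nbhd_antimono[of n "max m n" X] by auto
    then show "\<exists>k\<ge>1. Gr_nbhd k X \<subseteq> S \<inter> T" by blast
  qed
  moreover have "?P (\<Union>K)" if "\<forall>U\<in>K. ?P U" for K
    using that by (meson Sup_least Union_iff Union_upper order_trans)
  ultimately have "istopology ?P"
    unfolding istopology_def by blast
  then show ?thesis
    unfolding Gr_topology_def by (simp add: topology_inverse')
qed

definition Gr_borel :: "'a::field Vinf set measure" where
  "Gr_borel = sigma Gr {U. openin Gr_topology U}"

(* With respect to V_infinity = V_n + {first n coordinates zero}, these are the block maps
   A + id with A in GL(n, F_q). *)
definition GLn :: "nat \<Rightarrow> ('a::field Vinf \<Rightarrow> 'a Vinf) set" where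
  "GLn n = {g. Vector_Spaces.linear scale scale g \<and> bij g \<and> g ` V n \<subseteq> V n \<and>
               (\<forall>\<xi>. (\<forall>i<n. Poly_Mapping.lookup \<xi> i = 0) \<longrightarrow> g \<xi> = \<xi>)}"

definition GLinf :: "('a::field Vinf \<Rightarrow> 'a Vinf) set" where
  "GLinf = (\<Union>n. GLn n)"

definition invariant_prob_measure :: "'a::field Vinf set measure \<Rightarrow> bool" where
  "invariant_prob_measure M \<longleftrightarrow>
     sets M = sets Gr_borel \<and> prob_space M \<and>
     (\<forall>g\<in>GLinf. distr M Gr_borel (\<lambda>X. g ` X) = M)"

definition ergodic_measure :: "'a::field Vinf set measure \<Rightarrow> bool" where
  "ergodic_measure M \<longleftrightarrow>
     invariant_prob_measure M \<and>
     (\<forall>A\<in>sets M. (\<forall>g\<in>GLinf. (\<lambda>X. g ` X) ` A = A) \<longrightarrow> emeasure M A = 0 \<or> emeasure M A = 1)"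

(* B is mapped injectively to a basis of the quotient space V_infinity / X *)
definition basis_modulo :: "'a::field Vinf set \<Rightarrow> 'a Vinf set \<Rightarrow> bool" where
  "basis_modulo X B \<longleftrightarrow>
     (\<forall>S c. finite S \<longrightarrow> S \<subseteq> B \<longrightarrow> (\<Sum>b\<in>S. scale (c b) b) \<in> X \<longrightarrow> (\<forall>b\<in>S. c b = 0)) \<and>
     (\<forall>v. \<exists>S c. finite S \<and> S \<subseteq> B \<and> v - (\<Sum>b\<in>S. scale (c b) b) \<in> X)"

definition has_codim :: "'a::field Vinf set \<Rightarrow> nat \<Rightarrow> bool" where
  "has_codim X k \<longleftrightarrow> (\<exists>B. finite B \<and> card B = k \<and> basis_modulo X B)"

end

theory Submission
  imports Defs
begin

text \<open>
  The codimension of \<open>X\<close> is an invariant Borel function of \<open>X\<close>, so it is almost surely constant under an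
  ergodic measure. Conversely, for each \<open>\<kappa>\<close> there is exactly one invariant probability measure under
  which the codimension is almost surely \<open>\<kappa>\<close>. For finite \<open>\<kappa>\<close> it is the law of the kernel of a linear
  map to \<open>V \<kappa>\<close> whose values on the standard basis are independent and uniform. Uniqueness holds because
  the traces \<open>X \<inter> V N\<close> of codimension \<open>\<kappa>\<close> in \<open>V N\<close> form a single orbit of \<open>GLn N\<close>, hence are equally
  likely, and for large \<open>N\<close> almost all the mass sits on them. Conditioning such a measure on an invariant
  event gives another measure of the same kind, hence the same one; therefore it is ergodic.
\<close>

section \<open>Codimension and counting\<close>

text \<open>Everything is reduced to the finite spaces \<open>V N\<close>: with q the size of the
  field, codimension \<open>k\<close> means that \<open>card (X \<inter> V N)\<close> times the
  \<open>k\<close>-th power of q equals \<open>card (V N)\<close> for all large \<open>N\<close>. In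
  this form the codimension is visibly Borel and stable under the group, and dimension arguments
  become counting. The value \<infinity> needs an argument of its own, because the traces on
  \<open>V N\<close> then have no common dimension and do not form a single orbit. Instead, the
  density of \<open>X \<inter> V N\<close> in \<open>V N\<close> tends to 0 almost surely, and
  invariance then excludes every nonzero vector almost surely; only the Dirac mass at
  \<open>{0}\<close> is left. An element of \<open>GLn m\<close> is guaranteed to preserve
  \<open>V n\<close> only for \<open>n \<ge> m\<close>. This is why the families that generate the
  Borel sets and determine a measure carry a lower bound \<open>m\<close> on the level.\<close>

global_interpretation Vinf_pair:
  vector_space_pair "scale :: 'a::field \<Rightarrow> 'a Vinf \<Rightarrow> 'a Vinf" "scale :: 'a \<Rightarrow> 'a Vinf \<Rightarrow> 'a Vinf"
  by unfold_locales

lemma subspace_V: "Vinf.subspace (V n)"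
  by (auto simp: Vinf.subspace_def V_def lookup_add)

lemma finite_V: "finite (V n :: 'a::{field,finite} Vinf set)"
proof -
  let ?r = "\<lambda>\<xi>::'a Vinf. restrict (Poly_Mapping.lookup \<xi>) {..<n}"
  have "inj_on ?r (V n)"
  proof (rule inj_onI)
    fix \<xi> \<eta> :: "'a Vinf"
    assume *: "\<xi> \<in> V n" "\<eta> \<in> V n" "?r \<xi> = ?r \<eta>"
    have "Poly_Mapping.lookup \<xi> i = Poly_Mapping.lookup \<eta> i" for i
    proof (cases "i < n")
      case True
      then show ?thesis using fun_cong[OF *(3), of i] by simp
    next
      case False
      then show ?thesis using *(1,2) by (simp add: V_def)
    qed
    then show "\<xi> = \<eta>" by (simp add: poly_mapping_eq_iff fun_eq_iff)
  qed
  moreover have "finite (?r ` V n)"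
  proof (rule finite_subset)
    show "?r ` V n \<subseteq> {..<n} \<rightarrow>\<^sub>E UNIV" by (simp add: image_subset_iff)
    show "finite ({..<n} \<rightarrow>\<^sub>E (UNIV :: 'a set))" by (rule finite_PiE) simp_all
  qed
  ultimately show ?thesis by (rule finite_imageD[rotated])
qed

lemma zero_in_V [simp]: "0 \<in> V n"
  by (simp add: V_def)

lemma finite_subset_V:
  assumes "finite S"
  shows "\<forall>\<^sub>F n in sequentially. S \<subseteq> V n"
proof -
  have "\<forall>\<^sub>F n in sequentially. \<xi> \<in> V n" for \<xi> :: "'a Vinf"
  proof -
    obtain m where "\<forall>i\<in>Poly_Mapping.keys \<xi>. i < m"
      using finite_nat_set_iff_bounded[THEN iffD1, OF finite_keys] by blast
    then have "\<xi> \<in> V n" if "n \<ge> m" for n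
      using that \<open>\<forall>i\<in>Poly_Mapping.keys \<xi>. i < m\<close> unfolding V_def mem_Collect_eq
      by (metis in_keys_iff leD order_trans)
    then show ?thesis unfolding eventually_sequentially by blast
  qed
  then have "\<forall>\<^sub>F n in sequentially. \<forall>\<xi>\<in>S. \<xi> \<in> V n"
    using assms by (intro eventually_ball_finite) auto
  then show ?thesis by (rule eventually_mono) blast
qed

lemma ex_in_V: "\<exists>n. \<xi> \<in> V n"
  using eventually_happens[OF finite_subset_V[of "{\<xi>}"]] by auto

abbreviation comb :: "'a::field Vinf set \<Rightarrow> ('a Vinf \<Rightarrow> 'a) \<Rightarrow> 'a Vinf" where
  "comb B c \<equiv> \<Sum>b\<in>B. scale (c b) b"

text \<open>Coefficients on a subset extend by zero to all of \<open>B\<close>, so for finite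
  \<open>B\<close> the quantification over finite subfamilies disappears.\<close>

lemma basis_modulo_finite:
  assumes "finite B"
  shows "basis_modulo X B \<longleftrightarrow>
    (\<forall>c. comb B c \<in> X \<longrightarrow> (\<forall>b\<in>B. c b = 0)) \<and> (\<forall>v. \<exists>c. v - comb B c \<in> X)"
proof -
  have ext: "comb S c = comb B (\<lambda>b. if b \<in> S then c b else 0)" if "S \<subseteq> B" for S c
    using that assms by (intro sum.mono_neutral_cong_left) auto
  show ?thesis
    unfolding basis_modulo_def
  proof (intro iffI conjI allI impI; (elim conjE)?)
    fix c assume "\<forall>S c. finite S \<longrightarrow> S \<subseteq> B \<longrightarrow> comb S c \<in> X \<longrightarrow> (\<forall>b\<in>S. c b = 0)" "comb B c \<in> X"
    then show "\<forall>b\<in>B. c b = 0" using assms by blast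
  next
    fix v assume "\<forall>v. \<exists>S c. finite S \<and> S \<subseteq> B \<and> v - comb S c \<in> X"
    then obtain S c where "S \<subseteq> B" "v - comb S c \<in> X" by blast
    then show "\<exists>c. v - comb B c \<in> X" unfolding ext[OF \<open>S \<subseteq> B\<close>] by (rule_tac exI)
  next
    fix S c assume *: "\<forall>c. comb B c \<in> X \<longrightarrow> (\<forall>b\<in>B. c b = 0)" "S \<subseteq> B" "comb S c \<in> X"
    then have "\<forall>b\<in>B. (if b \<in> S then c b else 0) = 0" unfolding ext[OF *(2)]
      by (intro *(1)[rule_format, of "\<lambda>b. if b \<in> S then c b else 0"] ballI)
    then show "\<forall>b\<in>S. c b = 0" using *(2) by (auto split: if_splits)
  next
    fix v assume "\<forall>v. \<exists>c. v - comb B c \<in> X"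
    then show "\<exists>S c. finite S \<and> S \<subseteq> B \<and> v - comb S c \<in> X" using assms by blast
  qed
qed

text \<open>\<open>W\<close> is a disjoint union of cosets of \<open>Z\<close>, one for each
  coefficient family on \<open>B\<close>. Taking the families extensional makes each coset count
  exactly once.\<close>

lemma card_eq_mult_power:
  fixes W Z :: "'a::{field,finite} Vinf set"
  assumes Z: "Vinf.subspace Z" "Z \<subseteq> W" and W: "Vinf.subspace W" and B: "finite B" "B \<subseteq> W"
    and indep: "\<And>c. comb B c \<in> Z \<Longrightarrow> \<forall>b\<in>B. c b = 0"
    and gen: "\<And>v. v \<in> W \<Longrightarrow> \<exists>c. v - comb B c \<in> Z"
  shows "card W = card Z * CARD('a) ^ card B"
proof -
  let ?f = "\<lambda>(z, c). z + comb B c"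
  let ?D = "Z \<times> (B \<rightarrow>\<^sub>E (UNIV :: 'a set))"
  have comb_W: "comb B c \<in> W" for c
    using B W by (auto intro!: Vinf.subspace_sum Vinf.subspace_scale)
  have "inj_on ?f ?D"
  proof (rule inj_onI, clarify)
    fix z c z' c' assume *: "z \<in> Z" "z' \<in> Z" "c \<in> B \<rightarrow>\<^sub>E (UNIV :: 'a set)" "c' \<in> B \<rightarrow>\<^sub>E (UNIV :: 'a set)"
      "z + comb B c = z' + comb B c'"
    have "comb B (\<lambda>b. c b - c' b) = z' - z"
      using *(5) by (simp add: Vinf.scale_left_diff_distrib sum_subtractf algebra_simps)
    also have "\<dots> \<in> Z" using * Z by (simp add: Vinf.subspace_diff)
    finally have "\<forall>b\<in>B. c b = c' b" using indep by fastforce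
    then have "c = c'" using PiE_ext[OF *(3,4)] by blast
    then show "z = z' \<and> c = c'" using * by simp
  qed
  moreover have "?f ` ?D = W"
  proof (intro equalityI subsetI)
    fix w assume "w \<in> ?f ` ?D"
    then show "w \<in> W" using Z W comb_W by (auto intro!: Vinf.subspace_add)
  next
    fix w assume "w \<in> W"
    then obtain c where c: "w - comb B c \<in> Z" using gen by blast
    have "comb B (restrict c B) = comb B c" by (rule sum.cong) auto
    then have "w = ?f (w - comb B c, restrict c B)" by simp
    then show "w \<in> ?f ` ?D" by (rule image_eqI) (use c in auto)
  qed
  ultimately have "card W = card ?D" using card_image[of ?f ?D] by simp
  then show ?thesis by (simp add: card_cartesian_product card_PiE B)
qed

text \<open>As soon as \<open>V N\<close> contains a basis modulo \<open>X\<close>, that basis is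
  also a basis of \<open>V N\<close> modulo \<open>X \<inter> V N\<close>.\<close>

lemma eventually_card_codim:
  fixes X :: "'a::{field,finite} Vinf set"
  assumes X: "Vinf.subspace X" and "has_codim X k"
  shows "\<forall>\<^sub>F N in sequentially. card (X \<inter> V N) * CARD('a) ^ k = card (V N :: 'a Vinf set)"
proof -
  obtain B where B: "finite B" "card B = k" "basis_modulo X B"
    using assms by (auto simp: has_codim_def)
  note bm = B(3)[unfolded basis_modulo_finite[OF B(1)]]
  from finite_subset_V[OF B(1)] show ?thesis
  proof eventually_elim
    fix N assume N: "B \<subseteq> V N"
    have comb: "comb B c \<in> V N" for c
      using N subspace_V[of N] by (auto intro!: Vinf.subspace_sum Vinf.subspace_scale)
    have "card (V N :: 'a Vinf set) = card (X \<inter> V N) * CARD('a) ^ card B"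
    proof (rule card_eq_mult_power)
      show "\<exists>c. v - comb B c \<in> X \<inter> V N" if "v \<in> V N" for v
        using bm comb that subspace_V[of N] Vinf.subspace_diff by blast
    qed (use X N B bm subspace_V in \<open>auto intro: Vinf.subspace_inter\<close>)
    then show "card (X \<inter> V N) * CARD('a) ^ k = card (V N :: 'a Vinf set)" by (simp add: B)
  qed
qed

text \<open>A nontrivial relation modulo \<open>X\<close> expresses one of its vectors through the
  others, so a spanning set that is not a basis can be shrunk.\<close>

lemma has_codim_of_finite_spanning:
  assumes X: "Vinf.subspace X"
  shows "finite B \<Longrightarrow> (\<And>v. \<exists>c. v - comb B c \<in> X) \<Longrightarrow> \<exists>k. has_codim X k"
proof (induction "card B" arbitrary: B rule: less_induct)
  case less
  note gen = less.prems(2)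
  show ?case
  proof (cases "basis_modulo X B")
    case True
    then have "has_codim X (card B)" using less.prems(1) unfolding has_codim_def
      by (intro exI[of _ B]) simp
    then show ?thesis ..
  next
    case False
    then have "\<not> (\<forall>c. comb B c \<in> X \<longrightarrow> (\<forall>b\<in>B. c b = 0))"
      unfolding basis_modulo_finite[OF less.prems(1)] using gen by simp
    then obtain c b0 where c: "comb B c \<in> X" and b0: "b0 \<in> B" "c b0 \<noteq> 0"
      by auto
    let ?B = "B - {b0}"
    have split: "comb B d = scale (d b0) b0 + comb ?B d" for d
      using b0 less.prems by (simp add: sum.remove)
    have "\<exists>d. v - comb ?B d \<in> X" for v
    proof -
      obtain d where d: "v - comb B d \<in> X" using gen by blast
      \<comment> \<open>Subtracting \<open>t\<close> times the relation \<open>c\<close> from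
        \<open>d\<close> cancels the coefficient of \<open>b0\<close>.\<close>
      define t where "t = d b0 / c b0"
      have t: "t * c b0 = d b0" using b0 by (simp add: t_def)
      have "comb ?B (\<lambda>b. d b - t * c b) = comb ?B d - scale t (comb ?B c)"
        by (simp add: Vinf.scale_left_diff_distrib sum_subtractf Vinf.scale_sum_right)
      then have "v - comb ?B (\<lambda>b. d b - t * c b) = (v - comb B d) + scale t (comb B c)"
        by (simp add: split[of c] split[of d] Vinf.scale_right_distrib t)
      also have "\<dots> \<in> X" using X c d by (simp add: Vinf.subspace_add Vinf.subspace_scale)
      finally show ?thesis by (rule exI[where x = "\<lambda>b. d b - t * c b"])
    qed
    then show ?thesis
      using less.hyps[of ?B] b0 less.prems(1) by (meson card_Diff1_less finite_Diff)
  qed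
qed

text \<open>There are \<open>m\<close> vectors pairwise incongruent modulo \<open>X\<close>: a
  finite set that met every coset would span the quotient, so it can always be enlarged. Once
  \<open>V N\<close> contains them, it contains \<open>m\<close> disjoint translates of
  \<open>X \<inter> V N\<close>.\<close>

lemma infinite_codim_eventually:
  fixes X :: "'a::{field,finite} Vinf set"
  assumes X: "Vinf.subspace X" and inf: "\<And>k. \<not> has_codim X k"
  shows "\<forall>\<^sub>F N in sequentially. m * card (X \<inter> V N) \<le> card (V N :: 'a Vinf set)"
proof -
  have "\<exists>R. finite R \<and> card R = m \<and> (\<forall>r\<in>R. \<forall>s\<in>R. r - s \<in> X \<longrightarrow> r = s)"
  proof (induction m)
    case (Suc m)
    then obtain R where R: "finite R" "card R = m" "\<And>r s. r \<in> R \<Longrightarrow> s \<in> R \<Longrightarrow> r - s \<in> X \<Longrightarrow> r = s"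
      by blast
    have "\<exists>v. \<forall>r\<in>R. v - r \<notin> X"
    proof (rule ccontr)
      assume *: "\<not> ?thesis"
      have "\<exists>c. v - comb R c \<in> X" for v
      proof -
        obtain r where r: "r \<in> R" "v - r \<in> X" using * by blast
        have "comb R (\<lambda>b. if b = r then 1 else 0) = (\<Sum>b\<in>R. if b = r then b else 0)"
          by (rule sum.cong) auto
        then show ?thesis using r R(1) by (intro exI[of _ "\<lambda>b. if b = r then 1 else 0"]) simp
      qed
      then show False using has_codim_of_finite_spanning[OF X R(1)] inf by blast
    qed
    then obtain v where v: "\<And>r. r \<in> R \<Longrightarrow> v - r \<notin> X" by blast
    then have v': "r - v \<notin> X" if "r \<in> R" for r
      using that Vinf.subspace_neg[OF X, of "r - v"] by auto
    have "v \<notin> R" using v Vinf.subspace_0[OF X] by force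
    then show ?case using R v v' by (intro exI[of _ "insert v R"]) auto
  qed auto
  then obtain R where R: "finite R" "card R = m" "\<And>r s. r \<in> R \<Longrightarrow> s \<in> R \<Longrightarrow> r - s \<in> X \<Longrightarrow> r = s"
    by blast
  from finite_subset_V[OF R(1)] show ?thesis
  proof eventually_elim
    fix N assume N: "R \<subseteq> V N"
    let ?f = "\<lambda>(r, x). r + x"
    have "inj_on ?f (R \<times> (X \<inter> V N))"
    proof (rule inj_onI, clarify)
      fix r x s y assume *: "r \<in> R" "s \<in> R" "x \<in> X" "y \<in> X" "r + x = s + y"
      then have "r - s = y - x" by (simp add: algebra_simps)
      then have "r - s \<in> X" using * X by (simp add: Vinf.subspace_diff)
      then have "r = s" using R * by blast
      then show "r = s \<and> x = y" using * by simp
    qed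
    moreover have "?f ` (R \<times> (X \<inter> V N)) \<subseteq> V N"
      using N subspace_V[of N] by (auto intro!: Vinf.subspace_add)
    ultimately have "card (R \<times> (X \<inter> V N)) \<le> card (V N :: 'a Vinf set)"
      by (metis card_inj_on_le finite_V)
    then show "m * card (X \<inter> V N) \<le> card (V N :: 'a Vinf set)"
      by (simp add: card_cartesian_product R)
  qed
qed

lemma card_inter_V_pos:
  fixes X :: "'a::{field,finite} Vinf set"
  assumes "Vinf.subspace X"
  shows "card (X \<inter> V N) > 0"
  using assms finite_V[of N] Vinf.subspace_0 zero_in_V by (subst card_gt_0_iff) blast

lemma one_less_card_field: "1 < CARD('a::{field,finite})"
  using card_mono[of UNIV "{0, 1 :: 'a}"] by simp

lemma card_eventually_unique:
  fixes X :: "'a::{field,finite} Vinf set"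
  assumes X: "Vinf.subspace X"
    and k: "\<forall>\<^sub>F N in sequentially. card (X \<inter> V N) * CARD('a) ^ k = card (V N :: 'a Vinf set)"
    and l: "\<forall>\<^sub>F N in sequentially. card (X \<inter> V N) * CARD('a) ^ l = card (V N :: 'a Vinf set)"
  shows "k = l"
proof -
  have "\<forall>\<^sub>F N in sequentially. k = l"
    using k l
  proof eventually_elim
    case (elim N)
    then have "card (X \<inter> V N) * CARD('a) ^ k = card (X \<inter> V N) * CARD('a) ^ l" by simp
    then show ?case
      using card_inter_V_pos[OF X, of N] one_less_card_field[where 'a = 'a] by simp
  qed
  then show ?thesis by simp
qed

text \<open>For the converse, infinite codimension would make \<open>V N\<close> eventually at least
  \<open>Suc (CARD('a) ^ k)\<close> times as large as the trace, one more than the assumed ratio.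
  Some finite codimension therefore exists, and the ratio of cardinalities identifies it as
  \<open>k\<close>.\<close>

lemma has_codim_iff:
  fixes X :: "'a::{field,finite} Vinf set"
  assumes X: "Vinf.subspace X"
  shows "has_codim X k \<longleftrightarrow>
    (\<forall>\<^sub>F N in sequentially. card (X \<inter> V N) * CARD('a) ^ k = card (V N :: 'a Vinf set))"
proof
  assume ev: "\<forall>\<^sub>F N in sequentially. card (X \<inter> V N) * CARD('a) ^ k = card (V N :: 'a Vinf set)"
  have "\<exists>l. has_codim X l"
  proof (rule ccontr)
    assume "\<not> ?thesis"
    then have "\<forall>\<^sub>F N in sequentially. Suc (CARD('a) ^ k) * card (X \<inter> V N) \<le> card (V N :: 'a Vinf set)"
      by (intro infinite_codim_eventually[OF X]) simp
    with ev have "\<forall>\<^sub>F N in sequentially. False"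
    proof eventually_elim
      case (elim N)
      then show ?case using card_inter_V_pos[OF X, of N] by (simp add: mult.commute)
    qed
    then show False by simp
  qed
  then obtain l where l: "has_codim X l" ..
  then show "has_codim X k"
    using card_eventually_unique[OF X ev eventually_card_codim[OF X l]] by simp
qed (rule eventually_card_codim[OF X])

lemma has_codim_unique:
  fixes X :: "'a::{field,finite} Vinf set"
  assumes "Vinf.subspace X" "has_codim X k" "has_codim X l"
  shows "k = l"
  using assms card_eventually_unique eventually_card_codim by blast

section \<open>The action of the general linear groups\<close>

lemma linear_scale_iff:
  "Vector_Spaces.linear scale scale f \<longleftrightarrow>
    (\<forall>x y. f (x + y) = f x + f y) \<and> (\<forall>c x. f (scale c x) = scale c (f x))"
  unfolding Vector_Spaces.linear_iff by (simp add: Vinf.vector_space_axioms)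

text \<open>This is the projection onto \<open>V n\<close> along the complement on which
  \<open>GLn n\<close> acts as the identity.\<close>

definition trunc :: "nat \<Rightarrow> 'a::field Vinf \<Rightarrow> 'a Vinf" where
  "trunc n \<xi> = (\<Sum>i<n. Poly_Mapping.single i (Poly_Mapping.lookup \<xi> i))"

lemma lookup_trunc: "Poly_Mapping.lookup (trunc n \<xi>) i = (if i < n then Poly_Mapping.lookup \<xi> i else 0)"
  by (simp add: trunc_def lookup_sum lookup_single when_def)

lemma Vinf_eqI: "(\<And>i. Poly_Mapping.lookup \<xi> i = Poly_Mapping.lookup \<eta> i) \<Longrightarrow> \<xi> = \<eta>"
  by (simp add: poly_mapping_eq_iff fun_eq_iff)

lemma trunc_in_V: "trunc n \<xi> \<in> V n"
  by (simp add: V_def lookup_trunc)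

lemma trunc_add: "trunc n (\<xi> + \<eta>) = trunc n \<xi> + trunc n \<eta>"
  by (rule Vinf_eqI) (simp add: lookup_trunc lookup_add)

lemma trunc_diff: "trunc n (\<xi> - \<eta>) = trunc n \<xi> - trunc n \<eta>"
  by (rule Vinf_eqI) (simp add: lookup_trunc lookup_minus)

lemma trunc_scale: "trunc n (scale c \<xi>) = scale c (trunc n \<xi>)"
  by (rule Vinf_eqI) (simp add: lookup_trunc)

lemma trunc_of_V: "\<xi> \<in> V n \<Longrightarrow> trunc n \<xi> = \<xi>"
  by (rule Vinf_eqI) (auto simp add: lookup_trunc V_def)

lemma trunc_eq_0_iff: "trunc n \<xi> = 0 \<longleftrightarrow> (\<forall>i<n. Poly_Mapping.lookup \<xi> i = 0)"
  by (auto simp: poly_mapping_eq_iff fun_eq_iff lookup_trunc)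

lemma GLn_D:
  assumes "g \<in> GLn n"
  shows "Vector_Spaces.linear scale scale g" "bij g" "g ` V n \<subseteq> V n" "trunc n \<xi> = 0 \<Longrightarrow> g \<xi> = \<xi>"
  using assms unfolding GLn_def trunc_eq_0_iff by auto

lemma GLn_I:
  assumes "Vector_Spaces.linear scale scale g" "bij g" "g ` V n \<subseteq> V n" "\<And>\<xi>. trunc n \<xi> = 0 \<Longrightarrow> g \<xi> = \<xi>"
  shows "g \<in> GLn n"
  using assms unfolding GLn_def trunc_eq_0_iff by auto

text \<open>The difference \<open>\<xi> - trunc m \<xi>\<close> is fixed, so \<open>g\<close> moves
  only the part in \<open>V m\<close>, and moves it within \<open>V m\<close>.\<close>

lemma GLn_mono:
  assumes "m \<le> n"
  shows "GLn m \<subseteq> GLn n"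
proof
  fix g :: "'a Vinf \<Rightarrow> 'a Vinf" assume g: "g \<in> GLn m"
  interpret Vector_Spaces.linear scale scale g by (rule GLn_D[OF g])
  show "g \<in> GLn n"
  proof (rule GLn_I)
    show "g ` V n \<subseteq> V n"
    proof (rule image_subsetI)
      fix \<xi> :: "'a Vinf" assume \<xi>: "\<xi> \<in> V n"
      have "g (\<xi> - trunc m \<xi>) = \<xi> - trunc m \<xi>"
        by (rule GLn_D(4)[OF g]) (simp add: trunc_diff trunc_of_V trunc_in_V)
      moreover have "g \<xi> = g (trunc m \<xi>) + g (\<xi> - trunc m \<xi>)" by (simp flip: add)
      moreover have "g (trunc m \<xi>) \<in> V n"
        using GLn_D(3)[OF g] trunc_in_V V_mono[OF assms] by blast
      moreover have "trunc m \<xi> \<in> V n" using trunc_in_V V_mono[OF assms] by blast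
      ultimately show "g \<xi> \<in> V n" using \<xi> subspace_V[of n]
        by (metis Vinf.subspace_add Vinf.subspace_diff)
    qed
    show "g \<xi> = \<xi>" if "trunc n \<xi> = 0" for \<xi>
      using that assms by (intro GLn_D(4)[OF g]) (simp add: trunc_eq_0_iff)
  qed (use GLn_D[OF g] in auto)
qed

lemma GLn_image_V:
  fixes g :: "'a::{field,finite} Vinf \<Rightarrow> 'a Vinf"
  assumes "g \<in> GLn n"
  shows "g ` V n = V n"
  using GLn_D(2,3)[OF assms] finite_V
  by (intro endo_inj_surj) (auto simp: bij_def intro: inj_on_subset)

lemma GLn_inv:
  fixes g :: "'a::{field,finite} Vinf \<Rightarrow> 'a Vinf"
  assumes "g \<in> GLn n"
  shows "inv g \<in> GLn n"
proof (rule GLn_I)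
  note g = GLn_D[OF assms]
  show "Vector_Spaces.linear scale scale (inv g)"
    using g(1,2) bij_module_hom_imp_inv_module_hom by (simp add: module_hom_eq_linear[symmetric])
  show "bij (inv g)" using g(2) by (rule bij_imp_bij_inv)
  show "inv g ` V n \<subseteq> V n"
    using GLn_image_V[OF assms] g(2) by (metis bij_def image_inv_f_f order_refl)
  show "inv g \<xi> = \<xi>" if "trunc n \<xi> = 0" for \<xi>
    using g(4)[OF that] g(2) by (metis bij_inv_eq_iff)
qed

lemma GLn_image_inter_V:
  fixes g :: "'a::{field,finite} Vinf \<Rightarrow> 'a Vinf"
  assumes "g \<in> GLn n"
  shows "g ` X \<inter> V n = g ` (X \<inter> V n)"
  using GLn_image_V[OF assms] GLn_D(2)[OF assms] by (metis bij_def image_Int)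

lemma subspace_GLn_image:
  assumes "g \<in> GLn n" "Vinf.subspace X"
  shows "Vinf.subspace (g ` X)"
proof -
  interpret Vector_Spaces.linear scale scale g by (rule GLn_D[OF assms(1)])
  show ?thesis by (rule subspace_image[OF assms(2)])
qed

section \<open>Transitivity on subspaces of equal cardinality\<close>

lemma card_span:
  fixes A :: "'a::{field,finite} Vinf set"
  assumes "finite A" "Vinf.independent A"
  shows "card (Vinf.span A) = CARD('a) ^ card A"
proof -
  have "card (Vinf.span A) = card {0 :: 'a Vinf} * CARD('a) ^ card A"
  proof (rule card_eq_mult_power)
    show "\<forall>b\<in>A. c b = 0" if "comb A c \<in> {0}" for c
      using that Vinf.independentD[OF assms(2,1)] by blast
    show "\<exists>c. v - comb A c \<in> {0}" if "v \<in> Vinf.span A" for v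
    proof -
      obtain c where "v = comb A c" using \<open>v \<in> Vinf.span A\<close> unfolding Vinf.span_finite[OF assms(1)] by auto
      then show ?thesis by (intro exI[of _ c]) simp
    qed
  qed (auto simp: assms Vinf.span_zero Vinf.span_base)
  then show ?thesis by simp
qed

text \<open>The map is built on \<open>V N\<close> by matching bases adapted to \<open>Y\<close> and \<open>Y'\<close>, and extended by the
  identity on the complementary coordinates.\<close>

lemma GLn_transitive:
  fixes Y Y' :: "'a::{field,finite} Vinf set"
  assumes Y: "Vinf.subspace Y" "Y \<subseteq> V N" and Y': "Vinf.subspace Y'" "Y' \<subseteq> V N"
    and card_eq: "card Y = card Y'"
  shows "\<exists>g\<in>GLn N. g ` Y = Y'"
proof -
  have adapted: "\<exists>A C. A \<subseteq> C \<and> finite C \<and> Vinf.span A = Z \<and> Vinf.span C = V N \<and>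
      Vinf.independent C \<and> card Z = CARD('a) ^ card A \<and> card (V N :: 'a Vinf set) = CARD('a) ^ card C"
    if Z: "Vinf.subspace Z" "Z \<subseteq> V N" for Z :: "'a Vinf set"
  proof -
    obtain A where A: "A \<subseteq> Z" "Vinf.independent A" "Z \<subseteq> Vinf.span A"
      using Vinf.maximal_independent_subset by blast
    obtain C where C: "A \<subseteq> C" "C \<subseteq> V N" "Vinf.independent C" "V N \<subseteq> Vinf.span C"
      using Vinf.maximal_independent_subset_extend[of A "V N"] A Z by blast
    have "finite C" using finite_subset[OF C(2) finite_V] .
    moreover have "finite A" using finite_subset[OF C(1) \<open>finite C\<close>] .
    moreover have "Vinf.span A = Z" by (rule Vinf.span_subspace) (use A Z in auto)
    moreover have "Vinf.span C = V N" by (rule Vinf.span_subspace) (use C subspace_V in auto)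
    ultimately show ?thesis using A C card_span[of A] card_span[of C]
      by (intro exI[of _ A] exI[of _ C]) simp
  qed
  obtain A C where AC: "A \<subseteq> C" "finite C" "Vinf.span A = Y" "Vinf.span C = V N"
      "Vinf.independent C" "card Y = CARD('a) ^ card A" "card (V N :: 'a Vinf set) = CARD('a) ^ card C"
    using adapted[OF Y] by (elim exE conjE)
  obtain A' C' where AC': "A' \<subseteq> C'" "finite C'" "Vinf.span A' = Y'" "Vinf.span C' = V N"
      "Vinf.independent C'" "card Y' = CARD('a) ^ card A'" "card (V N :: 'a Vinf set) = CARD('a) ^ card C'"
    using adapted[OF Y'] by (elim exE conjE)
  have fin: "finite A" "finite A'" using AC AC' by (auto intro: finite_subset)
  have "card A = card A'" "card C = card C'"
    using AC(6,7) AC'(6,7) card_eq one_less_card_field[where 'a = 'a] by simp_all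
  then have "card (C - A) = card (C' - A')" using AC AC' fin by (simp add: card_Diff_subset)
  then obtain f2 where f2: "bij_betw f2 (C - A) (C' - A')"
    using finite_same_card_bij AC(2) AC'(2) by (metis finite_Diff)
  obtain f1 where f1: "bij_betw f1 A A'"
    using finite_same_card_bij[OF fin \<open>card A = card A'\<close>] by blast
  define h where "h x = (if x \<in> A then f1 x else f2 x)" for x
  have hA: "h ` A = A'" using f1 by (simp add: h_def bij_betw_def)
  have "h ` (C - A) = C' - A'" using f2 by (simp add: h_def bij_betw_def)
  then have hC: "h ` C = C'" using hA AC(1) AC'(1) by (metis Diff_partition image_Un)
  obtain L where L: "Vector_Spaces.linear scale scale L" "\<forall>x\<in>C. L x = h x"
    using Vinf_pair.linear_independent_extend[OF AC(5)] by blast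
  interpret L: Vector_Spaces.linear scale scale L by fact
  have "L ` A = A'" "L ` C = C'"
    using hA hC L(2) AC(1) by (auto simp: image_def subset_iff)
  then have LY: "L ` Y = Y'" and LV: "L ` V N = V N"
    using L.span_image[of A] L.span_image[of C] AC AC' by simp_all
  have "inj_on L (V N)"
    by (rule eq_card_imp_inj_on) (simp_all add: LV finite_V)
  then have L0: "x = 0" if "x \<in> V N" "L x = 0" for x
    using that by (metis inj_onD L.zero zero_in_V)
  define g where "g \<xi> = L (trunc N \<xi>) + (\<xi> - trunc N \<xi>)" for \<xi>
  have g_V: "g \<xi> = L \<xi>" if "\<xi> \<in> V N" for \<xi>
    using trunc_of_V[OF that] by (simp add: g_def)
  \<comment> \<open>The two summands of \<open>g \<xi>\<close> lie in complementary subspaces.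
    Truncation separates them, which reduces injectivity of \<open>g\<close> to that of
    \<open>L\<close> on \<open>V N\<close>.\<close>
  have trunc_g: "trunc N (g \<xi>) = L (trunc N \<xi>)" for \<xi>
  proof -
    have "L (trunc N \<xi>) \<in> V N" using LV trunc_in_V by blast
    then show ?thesis by (simp add: g_def trunc_add trunc_diff trunc_of_V trunc_in_V)
  qed
  have lin: "Vector_Spaces.linear scale scale g"
    unfolding linear_scale_iff g_def
    by (simp add: trunc_add trunc_scale L.add L.scale Vinf.scale_right_distrib
        Vinf.scale_right_diff_distrib)
  then interpret g: Vector_Spaces.linear scale scale g .
  have "inj g"
    unfolding g.inj_iff_eq_0
  proof (intro allI impI)
    fix \<xi> assume *: "g \<xi> = 0"
    then have "L (trunc N \<xi>) = 0" using trunc_g[of \<xi>] by (simp add: trunc_of_V)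
    then have "trunc N \<xi> = 0" using L0 trunc_in_V by blast
    then show "\<xi> = 0" using * by (simp add: g_def)
  qed
  moreover have "surj g"
  proof (rule surjI)
    fix \<eta>
    let ?z = "inv_into (V N) L (trunc N \<eta>)"
    have "?z \<in> V N" "L ?z = trunc N \<eta>"
      using LV trunc_in_V[of N \<eta>] by (auto intro: inv_into_into f_inv_into_f)
    then show "g (?z + (\<eta> - trunc N \<eta>)) = \<eta>"
      by (simp add: g_def trunc_add trunc_diff trunc_of_V trunc_in_V)
  qed
  ultimately have "bij g" by (rule bijI)
  have "g \<in> GLn N"
  proof (rule GLn_I[OF lin \<open>bij g\<close>])
    show "g ` V N \<subseteq> V N" using g_V LV by auto
    show "g \<xi> = \<xi>" if "trunc N \<xi> = 0" for \<xi> using that by (simp add: g_def)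
  qed
  moreover have "g ` Y = Y'" using LY g_V Y by (metis (no_types, lifting) image_cong subset_iff)
  ultimately show ?thesis by blast
qed

section \<open>Borel sets and invariant measures\<close>

lemma finite_range_Gr_nbhd: "finite (range (Gr_nbhd n :: 'a::{field,finite} Vinf set \<Rightarrow> _))"
proof (rule finite_subset)
  show "range (Gr_nbhd n :: 'a Vinf set \<Rightarrow> _) \<subseteq> (\<lambda>S. {X \<in> Gr. X \<inter> V n = S}) ` Pow (V n)"
    by (auto simp: Gr_nbhd_def)
qed (simp add: finite_V)

lemma openin_level: "openin Gr_topology {X \<in> Gr. P (X \<inter> V n)}"
  unfolding openin_Gr_topology
proof (intro conjI ballI)
  fix X assume X: "X \<in> {X \<in> Gr. P (X \<inter> V n)}"
  \<comment> \<open>The topology asks for neighbourhoods of index at least 1, while \<open>n\<close>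
    may be 0 here.\<close>
  have "Gr_nbhd (max n 1) X \<subseteq> Gr_nbhd n X" by (rule Gr_nbhd_antimono) simp
  also have "\<dots> \<subseteq> {X \<in> Gr. P (X \<inter> V n)}" using X by (auto simp: Gr_nbhd_def)
  finally show "\<exists>n'\<ge>1. Gr_nbhd n' X \<subseteq> {X \<in> Gr. P (X \<inter> V n)}"
    by (intro exI[of _ "max n 1"]) simp
qed auto

lemma space_Gr_borel: "space Gr_borel = Gr"
  unfolding Gr_borel_def by (rule space_measure_of) (auto simp: openin_Gr_topology)

lemma sets_Gr_borel_open: "sets Gr_borel = sigma_sets Gr {U. openin Gr_topology U}"
  unfolding Gr_borel_def by (rule sets_measure_of) (auto simp: openin_Gr_topology)

lemma level_in_sets: "{X \<in> Gr. P (X \<inter> V n)} \<in> sets Gr_borel"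
  unfolding sets_Gr_borel_open using openin_level by blast

lemma Gr_nbhd_in_sets: "Gr_nbhd n X \<in> sets Gr_borel"
  using level_in_sets[of "\<lambda>S. S = X \<inter> V n" n] by (simp add: Gr_nbhd_def)

lemma sets_Gr_borel:
  "sets (Gr_borel :: 'a::{field,finite} Vinf set measure) =
    sigma_sets Gr {Gr_nbhd n X | n X. m \<le> n}" (is "_ = sigma_sets Gr ?E")
proof
  have "U \<in> sigma_sets Gr ?E" if U: "openin Gr_topology U" for U :: "'a Vinf set set"
  proof -
    let ?D = "\<lambda>n. {W \<in> range (Gr_nbhd n). W \<subseteq> U}"
    have "U = (\<Union>n\<in>{m..}. \<Union>(?D n))"
    proof (intro equalityI subsetI)
      fix X assume X: "X \<in> U"
      then obtain n where n: "Gr_nbhd n X \<subseteq> U" "X \<in> Gr"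
        using U unfolding openin_Gr_topology by blast
      have "Gr_nbhd (max m n) X \<subseteq> Gr_nbhd n X" by (rule Gr_nbhd_antimono) simp
      then have "Gr_nbhd (max m n) X \<subseteq> U" using n by blast
      moreover have "X \<in> Gr_nbhd (max m n) X" using n by (simp add: Gr_nbhd_def)
      ultimately show "X \<in> (\<Union>n\<in>{m..}. \<Union>(?D n))" by (intro UN_I[of "max m n"]) auto
    qed auto
    moreover have "\<Union>(?D n) \<in> sigma_sets Gr ?E" if "n \<in> {m..}" for n
    proof (rule sigma_sets_UNION)
      show "countable (?D n)"
        by (rule countable_finite, rule finite_subset[OF _ finite_range_Gr_nbhd[of n]]) auto
    qed (use that in auto)
    then have "(\<Union>n\<in>{m..}. \<Union>(?D n)) \<in> sigma_sets Gr ?E"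
      by (intro sigma_sets_UNION) auto
    ultimately show ?thesis by simp
  qed
  then show "sets Gr_borel \<subseteq> sigma_sets Gr ?E"
    unfolding sets_Gr_borel_open by (intro sigma_sets_mono) auto
  show "sigma_sets Gr ?E \<subseteq> sets (Gr_borel :: 'a Vinf set measure)"
    unfolding space_Gr_borel[symmetric] using Gr_nbhd_in_sets by (intro sets.sigma_sets_subset) auto
qed

lemma measurable_Gr_borelI:
  fixes f :: "'b \<Rightarrow> 'a::{field,finite} Vinf set"
  assumes "f \<in> space M \<rightarrow> Gr" "\<And>n X. m \<le> n \<Longrightarrow> f -` Gr_nbhd n X \<inter> space M \<in> sets M"
  shows "f \<in> measurable M Gr_borel"
  by (rule measurable_sigma_sets[OF sets_Gr_borel]) (use assms in \<open>auto simp: Gr_nbhd_def\<close>)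

text \<open>Two neighbourhoods are either disjoint or nested. Together with \<open>{}\<close> and
  \<open>Gr\<close> they therefore form an intersection-stable generator, on which finite measures
  are determined.\<close>

lemma Gr_measure_eqI:
  fixes M M' :: "'a::{field,finite} Vinf set measure"
  assumes sets: "sets M = sets Gr_borel" "sets M' = sets Gr_borel"
    and prob: "prob_space M" "prob_space M'"
    and eq: "\<And>n X. m \<le> n \<Longrightarrow> emeasure M (Gr_nbhd n X) = emeasure M' (Gr_nbhd n X)"
  shows "M = M'"
proof -
  let ?E = "{Gr_nbhd n X | n X. m \<le> n} :: 'a Vinf set set set"
  let ?F = "{{}, Gr} \<union> ?E"
  have spaces: "space M = Gr" "space M' = Gr"
    using sets_eq_imp_space_eq[OF sets(1)] sets_eq_imp_space_eq[OF sets(2)]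
    by (simp_all add: space_Gr_borel)
  have nested: "Gr_nbhd n X \<inter> Gr_nbhd n' X' \<in> ?F" if "n \<le> n'" "m \<le> n'" for n n' and X X' :: "'a Vinf set"
  proof (cases "Gr_nbhd n X \<inter> Gr_nbhd n' X' = {}")
    case False
    then obtain Z where "Z \<in> Gr_nbhd n X" "Z \<in> Gr_nbhd n' X'" by blast
    then have Z: "Gr_nbhd n X = Gr_nbhd n Z" "Gr_nbhd n' X' = Gr_nbhd n' Z"
      by (auto simp: Gr_nbhd_def)
    have "Gr_nbhd n X \<inter> Gr_nbhd n' X' = Gr_nbhd n' X'"
      unfolding Z using Gr_nbhd_antimono[OF that(1), of Z] by blast
    then show ?thesis using that(2) by blast
  qed simp
  have E_Gr: "W \<subseteq> Gr" if "W \<in> ?F" for W using that by (auto simp: Gr_nbhd_def)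
  have sigma: "sigma_sets Gr ?F = sets Gr_borel"
  proof
    show "sigma_sets Gr ?F \<subseteq> sets (Gr_borel :: 'a Vinf set measure)"
      unfolding space_Gr_borel[symmetric] using Gr_nbhd_in_sets by (intro sets.sigma_sets_subset) auto
    show "sets (Gr_borel :: 'a Vinf set measure) \<subseteq> sigma_sets Gr ?F"
      unfolding sets_Gr_borel[of m] by (rule sigma_sets_mono') blast
  qed
  show ?thesis
  proof (rule measure_eqI_generator_eq[where E = ?F and \<Omega> = Gr and A = "\<lambda>_. Gr"])
    show "Int_stable ?F"
    proof (rule Int_stableI)
      fix W W' assume W: "W \<in> ?F" "W' \<in> ?F"
      show "W \<inter> W' \<in> ?F"
      proof (cases "W \<in> ?E \<and> W' \<in> ?E")
        case True
        then obtain n X n' X' where *: "W = Gr_nbhd n X" "W' = Gr_nbhd n' X'" "m \<le> n" "m \<le> n'"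
          by blast
        show ?thesis
        proof (cases "n \<le> n'")
          case True
          show ?thesis unfolding * by (rule nested[OF True *(4)])
        next
          case False
          show ?thesis unfolding * by (subst Int_commute, rule nested) (use False * in auto)
        qed
      next
        case False
        then have "W \<inter> W' \<in> {{}, W, W'}" using W E_Gr[OF W(1)] E_Gr[OF W(2)] by blast
        then show ?thesis using W by auto
      qed
    qed
    show "?F \<subseteq> Pow Gr" using E_Gr by blast
    show "sets M = sigma_sets Gr ?F" "sets M' = sigma_sets Gr ?F" using sets sigma by simp_all
    show "emeasure M W = emeasure M' W" if "W \<in> ?F" for W
      using that eq prob_space.emeasure_space_1[OF prob(1)] prob_space.emeasure_space_1[OF prob(2)]
      by (auto simp: spaces)
    show "emeasure M Gr \<noteq> \<infinity>" for i :: nat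
      using prob_space.emeasure_space_1[OF prob(1)] by (simp add: spaces)
  qed auto
qed

lemma codim_in_sets: "{X :: 'a::{field,finite} Vinf set. X \<in> Gr \<and> has_codim X k} \<in> sets Gr_borel"
proof -
  have "{X :: 'a Vinf set. X \<in> Gr \<and> has_codim X k} =
      {X \<in> space Gr_borel. \<exists>m. \<forall>N. N \<ge> m \<longrightarrow> card (X \<inter> V N) * CARD('a) ^ k = card (V N :: 'a Vinf set)}"
    unfolding space_Gr_borel Gr_def mem_Collect_eq
    by (intro Collect_cong conj_cong refl) (simp add: has_codim_iff eventually_sequentially)
  also have "\<dots> \<in> sets Gr_borel"
  proof (intro sets.sets_Collect_countable_Ex sets.sets_Collect_countable_All)
    fix m N
    show "{X \<in> space Gr_borel. N \<ge> m \<longrightarrow> card (X \<inter> V N) * CARD('a) ^ k = card (V N :: 'a Vinf set)} \<in> sets Gr_borel"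
      unfolding space_Gr_borel
      by (rule level_in_sets[of "\<lambda>S. N \<ge> m \<longrightarrow> card S * CARD('a) ^ k = card (V N :: 'a Vinf set)"])
  qed
  finally show ?thesis .
qed

text \<open>An element of \<open>GLn n\<close> preserves \<open>V n\<close>, so it commutes with
  taking traces on \<open>V n\<close> and permutes the neighbourhoods of level
  \<open>n\<close>.\<close>

lemma vimage_GLn_nbhd:
  fixes g :: "'a::{field,finite} Vinf \<Rightarrow> 'a Vinf"
  assumes g: "g \<in> GLn n"
  shows "(\<lambda>X. g ` X) -` Gr_nbhd n (g ` Y) \<inter> Gr = Gr_nbhd n Y"
proof -
  have "inj g" using GLn_D(2)[OF g] by (simp add: bij_def)
  then have "g ` X \<inter> V n = g ` Y \<inter> V n \<longleftrightarrow> X \<inter> V n = Y \<inter> V n" for X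
    by (simp add: GLn_image_inter_V[OF g] inj_image_eq_iff)
  then show ?thesis using subspace_GLn_image[OF g] by (auto simp: Gr_nbhd_def Gr_def)
qed

lemma image_inv_GLn:
  assumes "g \<in> GLn n"
  shows "g ` inv g ` Y = Y" "inv g ` g ` Y = Y"
  using GLn_D(2)[OF assms] by (simp_all add: bij_def image_f_inv_f image_inv_f_f)

lemma measurable_GLn:
  fixes g :: "'a::{field,finite} Vinf \<Rightarrow> 'a Vinf"
  assumes g: "g \<in> GLn m"
  shows "(\<lambda>X. g ` X) \<in> measurable Gr_borel Gr_borel"
proof (rule measurable_Gr_borelI)
  show "(\<lambda>X. g ` X) \<in> space Gr_borel \<rightarrow> Gr"
    using subspace_GLn_image[OF g] by (auto simp: space_Gr_borel Gr_def)
  fix n Y assume "m \<le> n"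
  then have g': "g \<in> GLn n" using g GLn_mono by blast
  show "(\<lambda>X. g ` X) -` Gr_nbhd n Y \<inter> space Gr_borel \<in> sets Gr_borel"
    using vimage_GLn_nbhd[OF g', of "inv g ` Y"] Gr_nbhd_in_sets
    by (simp add: space_Gr_borel image_inv_GLn[OF g'])
qed

text \<open>Invariance becomes a family of numerical equations, each involving only \<open>g\<close>
  and neighbourhoods at a level where \<open>g\<close> acts. These equations suffice: an element of
  \<open>GLn m\<close> belongs to every \<open>GLn n\<close> with \<open>n \<ge> m\<close>, and
  those levels determine the image measure.\<close>

lemma invariant_prob_measure_iff:
  fixes M :: "'a::{field,finite} Vinf set measure"
  shows "invariant_prob_measure M \<longleftrightarrow> sets M = sets Gr_borel \<and> prob_space M \<and>
    (\<forall>n. \<forall>g\<in>GLn n. \<forall>Y. emeasure M (Gr_nbhd n (g ` Y)) = emeasure M (Gr_nbhd n Y))"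
proof -
  have distr: "emeasure (distr M Gr_borel (\<lambda>X. g ` X)) (Gr_nbhd n (g ` Y)) = emeasure M (Gr_nbhd n Y)"
    if "sets M = sets Gr_borel" "g \<in> GLn n" for g n Y
  proof -
    have "space M = Gr" using sets_eq_imp_space_eq[OF that(1)] by (simp add: space_Gr_borel)
    moreover have "(\<lambda>X. g ` X) \<in> measurable M Gr_borel"
      using measurable_GLn[OF that(2)] that(1) by (simp cong: measurable_cong_sets)
    ultimately show ?thesis
      by (simp add: emeasure_distr Gr_nbhd_in_sets vimage_GLn_nbhd[OF that(2)])
  qed
  show ?thesis
  proof
    assume inv: "invariant_prob_measure M"
    then have "emeasure M (Gr_nbhd n (g ` Y)) = emeasure M (Gr_nbhd n Y)" if "g \<in> GLn n" for g n Y
      using distr[OF _ that, of Y] that unfolding invariant_prob_measure_def GLinf_def by auto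
    then show "sets M = sets Gr_borel \<and> prob_space M \<and>
      (\<forall>n. \<forall>g\<in>GLn n. \<forall>Y. emeasure M (Gr_nbhd n (g ` Y)) = emeasure M (Gr_nbhd n Y))"
      using inv unfolding invariant_prob_measure_def by blast
  next
    assume *: "sets M = sets Gr_borel \<and> prob_space M \<and>
      (\<forall>n. \<forall>g\<in>GLn n. \<forall>Y. emeasure M (Gr_nbhd n (g ` Y)) = emeasure M (Gr_nbhd n Y))"
    have "distr M Gr_borel (\<lambda>X. g ` X) = M" if g: "g \<in> GLn m" for g m
    proof (rule Gr_measure_eqI[where m = m])
      have "(\<lambda>X. g ` X) \<in> measurable M Gr_borel"
        using measurable_GLn[OF g] * by (simp cong: measurable_cong_sets)
      then show "prob_space (distr M Gr_borel (\<lambda>X. g ` X))"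
        using * by (intro prob_space.prob_space_distr) auto
      fix n Y assume "m \<le> n"
      then have g': "g \<in> GLn n" using g GLn_mono by blast
      have "emeasure (distr M Gr_borel (\<lambda>X. g ` X)) (Gr_nbhd n (g ` inv g ` Y))
          = emeasure M (Gr_nbhd n (g ` inv g ` Y))"
        using distr[OF _ g', of "inv g ` Y"] * g' by simp
      then show "emeasure (distr M Gr_borel (\<lambda>X. g ` X)) (Gr_nbhd n Y) = emeasure M (Gr_nbhd n Y)"
        by (simp only: image_inv_GLn[OF g'])
    qed (use * in auto)
    then show "invariant_prob_measure M"
      unfolding invariant_prob_measure_def GLinf_def using * by auto
  qed
qed

text \<open>From level \<open>m\<close> on, \<open>g\<close> maps the trace of \<open>X\<close>
  bijectively onto the trace of the image, so the cardinalities that define the codimension agree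
  eventually.\<close>

lemma has_codim_GLn_image:
  fixes g :: "'a::{field,finite} Vinf \<Rightarrow> 'a Vinf"
  assumes g: "g \<in> GLn m" and X: "Vinf.subspace X"
  shows "has_codim (g ` X) k \<longleftrightarrow> has_codim X k"
proof -
  have "\<forall>\<^sub>F N in sequentially. card (g ` X \<inter> V N) = card (X \<inter> V N)"
    using eventually_ge_at_top[of m]
  proof eventually_elim
    case (elim N)
    then have g': "g \<in> GLn N" using g GLn_mono by blast
    have "inj_on g (X \<inter> V N)" using GLn_D(2)[OF g] by (auto simp: bij_def intro: inj_on_subset)
    then show ?case by (simp add: GLn_image_inter_V[OF g'] card_image)
  qed
  then have "\<forall>\<^sub>F N in sequentially. card (g ` X \<inter> V N) * CARD('a) ^ k = card (V N :: 'a Vinf set) \<longleftrightarrow>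
      card (X \<inter> V N) * CARD('a) ^ k = card (V N :: 'a Vinf set)"
    by (rule eventually_mono) simp
  then have "(\<forall>\<^sub>F N in sequentially. card (g ` X \<inter> V N) * CARD('a) ^ k = card (V N :: 'a Vinf set)) \<longleftrightarrow>
    (\<forall>\<^sub>F N in sequentially. card (X \<inter> V N) * CARD('a) ^ k = card (V N :: 'a Vinf set))"
    by (rule eventually_subst)
  then show ?thesis
    by (simp add: has_codim_iff X subspace_GLn_image[OF g X])
qed

section \<open>Uniqueness of the invariant measure of given codimension\<close>

definition codim_is :: "'a::field Vinf set \<Rightarrow> enat \<Rightarrow> bool" where
  "codim_is X \<kappa> \<longleftrightarrow> (case \<kappa> of enat k \<Rightarrow> has_codim X k | \<infinity> \<Rightarrow> (\<forall>k. \<not> has_codim X k))"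

text \<open>Dominated convergence applied to indicators. The sets \<open>E n\<close> need not be
  monotone: a subspace can have the right relative codimension in \<open>V n\<close> and lose it at
  a later level.\<close>

lemma (in finite_measure) measure_Int_tendsto:
  assumes A: "A \<in> sets M" and E: "\<And>n::nat. E n \<in> sets M"
    and ev: "AE x in M. \<forall>\<^sub>F n in sequentially. x \<in> E n"
  shows "(\<lambda>n. measure M (A \<inter> E n)) \<longlonglongrightarrow> measure M A"
proof -
  have "(\<lambda>n. \<integral>x. indicator (A \<inter> E n) x \<partial>M) \<longlonglongrightarrow> (\<integral>x. indicat_real A x \<partial>M)"
  proof (rule integral_dominated_convergence[where w = "\<lambda>_. 1"])
    show "AE x in M. (\<lambda>n. indicat_real (A \<inter> E n) x) \<longlonglongrightarrow> indicator A x"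
      using ev
    proof eventually_elim
      case (elim x)
      have "\<forall>\<^sub>F n in sequentially. indicat_real (A \<inter> E n) x = indicator A x"
        using elim by eventually_elim (simp add: indicator_def)
      then show ?case by (rule tendsto_eventually)
    qed
  qed (use A E in \<open>auto simp: indicator_def\<close>)
  then show ?thesis using A E by (simp add: sets.Int)
qed

text \<open>By transitivity, all traces in \<open>S\<close> have the same probability
  \<open>p\<close>. Stating the result for every \<open>U \<subseteq> S\<close> with one
  \<open>p\<close> lets two invariant measures be compared by counting, without computing
  \<open>p\<close>.\<close>

lemma invariant_level_measure:
  fixes M :: "'a::{field,finite} Vinf set measure"
  assumes inv: "invariant_prob_measure M"
    and S: "\<And>Z. Z \<in> S \<Longrightarrow> Vinf.subspace Z \<and> Z \<subseteq> V N \<and> card Z = c"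
  shows "\<exists>p. \<forall>U. U \<subseteq> S \<longrightarrow> measure M {X \<in> Gr. X \<inter> V N \<in> U} = real (card U) * p"
proof -
  from inv have sets: "sets M = sets Gr_borel" and "prob_space M"
    and g: "\<And>g Y. g \<in> GLn N \<Longrightarrow> emeasure M (Gr_nbhd N (g ` Y)) = emeasure M (Gr_nbhd N Y)"
    unfolding invariant_prob_measure_iff by auto
  interpret prob_space M by fact
  have same: "measure M (Gr_nbhd N Z) = measure M (Gr_nbhd N Z')" if Z: "Z \<in> S" "Z' \<in> S" for Z Z'
  proof -
    obtain h where "h \<in> GLn N" "h ` Z = Z'"
      using GLn_transitive[of Z N Z'] S[OF Z(1)] S[OF Z(2)] by auto
    then show ?thesis using g[of h Z] by (simp add: measure_def)
  qed
  have "\<exists>p. \<forall>Z\<in>S. measure M (Gr_nbhd N Z) = p"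
    using same by (metis (no_types, opaque_lifting))
  then obtain p where p: "\<And>Z. Z \<in> S \<Longrightarrow> measure M (Gr_nbhd N Z) = p" by blast
  show ?thesis
  proof (intro exI allI impI)
    fix U assume U: "U \<subseteq> S"
    have fin: "finite U"
      by (rule finite_subset[of _ "Pow (V N)"]) (use U S finite_V in auto)
    have nbhd: "Gr_nbhd N Z = {X \<in> Gr. X \<inter> V N = Z}" if "Z \<in> U" for Z
      using S[of Z] U that by (auto simp: Gr_nbhd_def Int_absorb2)
    then have "{X \<in> Gr. X \<inter> V N \<in> U} = (\<Union>Z\<in>U. Gr_nbhd N Z)" by auto
    moreover have "measure M (\<Union>Z\<in>U. Gr_nbhd N Z) = (\<Sum>Z\<in>U. measure M (Gr_nbhd N Z))"
    proof (rule finite_measure_finite_Union[OF fin])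
      show "Gr_nbhd N ` U \<subseteq> events" using Gr_nbhd_in_sets sets by auto
      show "disjoint_family_on (Gr_nbhd N) U"
        unfolding disjoint_family_on_def using nbhd by auto
    qed
    ultimately show "measure M {X \<in> Gr. X \<inter> V N \<in> U} = real (card U) * p"
      using p U by (simp add: subset_iff)
  qed
qed

text \<open>Conditioned on \<open>codim (X \<inter> V N) = k\<close> in \<open>V N\<close>, the trace of an invariant random subspace on \<open>V N\<close>
  is uniformly distributed, whatever the invariant measure is. Let \<open>N\<close> tend to infinity.\<close>

lemma invariant_unique_finite_codim:
  fixes M1 M2 :: "'a::{field,finite} Vinf set measure"
  assumes inv: "invariant_prob_measure M1" "invariant_prob_measure M2"
    and codim: "AE X in M1. has_codim X k" "AE X in M2. has_codim X k"
  shows "M1 = M2"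
proof (rule Gr_measure_eqI[where m = 0])
  show sets: "sets M1 = sets Gr_borel" "sets M2 = sets Gr_borel"
    and prob: "prob_space M1" "prob_space M2"
    using inv unfolding invariant_prob_measure_iff by auto
  fix n and X :: "'a Vinf set"
  interpret M1: prob_space M1 by fact
  interpret M2: prob_space M2 by fact
  let ?A = "Gr_nbhd n X"
  define E where "E N = {X :: 'a Vinf set. X \<in> Gr \<and> card (X \<inter> V N) * CARD('a) ^ k = card (V N :: 'a Vinf set)}" for N
  have E_sets: "E N \<in> sets Gr_borel" for N
    unfolding E_def by (rule level_in_sets[of "\<lambda>S. card S * CARD('a) ^ k = card (V N :: 'a Vinf set)"])
  have lim: "(\<lambda>N. measure M (?A \<inter> E N)) \<longlonglongrightarrow> measure M ?A" "(\<lambda>N. measure M (E N)) \<longlonglongrightarrow> 1"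
    if M: "sets M = sets Gr_borel" "prob_space M" "AE X in M. has_codim X k" for M
  proof -
    interpret prob_space M by fact
    have sp: "space M = Gr" using sets_eq_imp_space_eq[OF M(1)] by (simp add: space_Gr_borel)
    have ev: "AE X in M. \<forall>\<^sub>F N in sequentially. X \<in> E N"
      using M(3) AE_space
    proof eventually_elim
      case (elim X)
      then show ?case using eventually_card_codim[of X k] by (simp add: E_def sp Gr_def)
    qed
    show "(\<lambda>N. measure M (?A \<inter> E N)) \<longlonglongrightarrow> measure M ?A"
      by (rule measure_Int_tendsto[OF _ _ ev]) (simp_all add: M E_sets Gr_nbhd_in_sets)
    have "(\<lambda>N. measure M (space M \<inter> E N)) \<longlonglongrightarrow> measure M (space M)"
      by (rule measure_Int_tendsto[OF sets.top _ ev]) (simp add: M E_sets)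
    moreover have "space M \<inter> E N = E N" for N by (auto simp: sp E_def)
    ultimately show "(\<lambda>N. measure M (E N)) \<longlonglongrightarrow> 1" by (simp add: prob_space)
  qed
  \<comment> \<open>Equality of conditional probabilities in multiplied-out form: \<open>E N\<close>
    is empty when \<open>N < k\<close>, so a quotient would need a side condition.\<close>
  have cross: "measure M1 (?A \<inter> E N) * measure M2 (E N) = measure M2 (?A \<inter> E N) * measure M1 (E N)"
    if "n \<le> N" for N
  proof -
    let ?S = "{Z :: 'a Vinf set. Vinf.subspace Z \<and> Z \<subseteq> V N \<and> card Z * CARD('a) ^ k = card (V N :: 'a Vinf set)}"
    let ?U = "{Z \<in> ?S. Z \<inter> V n = X \<inter> V n}"
    have S: "Vinf.subspace Z \<and> Z \<subseteq> V N \<and> card Z = card (V N :: 'a Vinf set) div CARD('a) ^ k"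
      if Z: "Z \<in> ?S" for Z
    proof -
      have eq: "card (V N :: 'a Vinf set) = card Z * CARD('a) ^ k" using Z by simp
      have "card Z = card (V N :: 'a Vinf set) div CARD('a) ^ k" unfolding eq by simp
      then show ?thesis using Z by simp
    qed
    have "\<exists>p. \<forall>U. U \<subseteq> ?S \<longrightarrow> measure M1 {X \<in> Gr. X \<inter> V N \<in> U} = real (card U) * p"
      by (rule invariant_level_measure[OF inv(1) S])
    then obtain p1 where p1: "\<forall>U. U \<subseteq> ?S \<longrightarrow> measure M1 {X \<in> Gr. X \<inter> V N \<in> U} = real (card U) * p1"
      by (elim exE)
    have "\<exists>p. \<forall>U. U \<subseteq> ?S \<longrightarrow> measure M2 {X \<in> Gr. X \<inter> V N \<in> U} = real (card U) * p"
      by (rule invariant_level_measure[OF inv(2) S])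
    then obtain p2 where p2: "\<forall>U. U \<subseteq> ?S \<longrightarrow> measure M2 {X \<in> Gr. X \<inter> V N \<in> U} = real (card U) * p2"
      by (elim exE)
    have E: "E N = {X \<in> Gr. X \<inter> V N \<in> ?S}"
      using subspace_V[of N] by (auto simp: E_def Gr_def intro: Vinf.subspace_inter)
    have "Z \<inter> V N \<inter> V n = Z \<inter> V n" for Z :: "'a Vinf set"
      using V_mono[OF that] by blast
    then have AE: "?A \<inter> E N = {X \<in> Gr. X \<inter> V N \<in> ?U}"
      unfolding E by (auto simp: Gr_nbhd_def)
    have "?U \<subseteq> ?S" by blast
    then show ?thesis unfolding AE unfolding E by (simp only: p1[rule_format] p2[rule_format] order_refl mult_ac)
  qed
  have "(\<lambda>N. measure M1 (?A \<inter> E N) * measure M2 (E N)) \<longlonglongrightarrow> measure M1 ?A * 1"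
    by (intro tendsto_mult lim sets prob codim)
  moreover have "(\<lambda>N. measure M2 (?A \<inter> E N) * measure M1 (E N)) \<longlonglongrightarrow> measure M2 ?A * 1"
    by (intro tendsto_mult lim sets prob codim)
  moreover have "\<forall>\<^sub>F N in sequentially. measure M1 (?A \<inter> E N) * measure M2 (E N) =
      measure M2 (?A \<inter> E N) * measure M1 (E N)"
    using eventually_ge_at_top[of n] by eventually_elim (rule cross)
  ultimately have "measure M1 ?A * 1 = measure M2 ?A * 1"
    using LIMSEQ_unique tendsto_cong[THEN iffD1] by fast
  then show "emeasure M1 ?A = emeasure M2 ?A"
    by (simp add: M1.emeasure_eq_measure M2.emeasure_eq_measure)
qed

section \<open>Invariant measures with almost surely infinite codimension\<close>

lemma mem_set_in_sets: "{X \<in> Gr. v \<in> X} \<in> sets Gr_borel"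
proof -
  obtain n where "v \<in> V n" using ex_in_V by blast
  then show ?thesis using level_in_sets[of "\<lambda>S. v \<in> S" n] by simp
qed

text \<open>Membership of \<open>v\<close> in a subspace depends only on the line through
  \<open>v\<close>, and \<open>GLn N\<close> is transitive on the lines in \<open>V N\<close>. The
  chosen \<open>g\<close> matches the lines and may send \<open>v\<close> to a multiple of
  \<open>w\<close>.\<close>

lemma invariant_measure_mem_eq:
  fixes M :: "'a::{field,finite} Vinf set measure"
  assumes inv: "invariant_prob_measure M" and vw: "v \<in> V N" "w \<in> V N" "v \<noteq> 0" "w \<noteq> 0"
  shows "measure M {X \<in> Gr. v \<in> X} = measure M {X \<in> Gr. w \<in> X}"
proof -
  have mem_iff: "u \<in> X \<longleftrightarrow> Vinf.span {u} \<subseteq> X" if "Vinf.subspace X" for u and X :: "'a Vinf set"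
    using that by (metis Vinf.span_base Vinf.span_minimal empty_subsetI insert_subset insertI1 subset_iff)
  obtain g where g: "g \<in> GLn N" "g ` Vinf.span {v} = Vinf.span {w}"
    using GLn_transitive[of "Vinf.span {v}" N "Vinf.span {w}"] mem_iff[OF subspace_V] vw
    by (auto simp: card_span Vinf.dependent_single)
  have sets: "sets M = sets Gr_borel" and distr: "distr M Gr_borel (\<lambda>X. g ` X) = M"
    using inv g(1) unfolding invariant_prob_measure_def GLinf_def by auto
  have sp: "space M = Gr" using sets_eq_imp_space_eq[OF sets] by (simp add: space_Gr_borel)
  have meas: "(\<lambda>X. g ` X) \<in> measurable M Gr_borel"
    using measurable_GLn[OF g(1)] sets by (simp cong: measurable_cong_sets)
  have "inj g" using GLn_D(2)[OF g(1)] by (simp add: bij_def)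
  then have "w \<in> g ` X \<longleftrightarrow> v \<in> X" if "X \<in> Gr" for X
    using that mem_iff[of "g ` X" w] mem_iff[of X v] subspace_GLn_image[OF g(1), of X]
    by (simp add: Gr_def inj_image_subset_iff flip: g(2))
  then have "(\<lambda>X. g ` X) -` {X \<in> Gr. w \<in> X} \<inter> space M = {X \<in> Gr. v \<in> X}"
    using subspace_GLn_image[OF g(1)] unfolding sp by (auto simp: Gr_def)
  then have "measure (distr M Gr_borel (\<lambda>X. g ` X)) {X \<in> Gr. w \<in> X} = measure M {X \<in> Gr. v \<in> X}"
    by (simp add: measure_distr[OF meas mem_set_in_sets])
  then show ?thesis unfolding distr by simp
qed

text \<open>All nonzero \<open>v \<in> V N\<close> have the same probability to lie in \<open>X\<close>, which is therefore bounded by the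
  expected density of \<open>X \<inter> V N\<close> in \<open>V N\<close>; that density tends to 0.\<close>

lemma invariant_infinite_codim_measure_mem:
  fixes M :: "'a::{field,finite} Vinf set measure"
  assumes inv: "invariant_prob_measure M" and codim: "AE X in M. \<forall>k. \<not> has_codim X k" and v: "v \<noteq> 0"
  shows "measure M {X \<in> Gr. v \<in> X} = 0"
proof -
  from inv have sets: "sets M = sets Gr_borel" and "prob_space M"
    unfolding invariant_prob_measure_iff by auto
  interpret prob_space M by fact
  have sp: "space M = Gr" using sets_eq_imp_space_eq[OF sets] by (simp add: space_Gr_borel)
  let ?p = "measure M {X \<in> Gr. v \<in> X}"
  let ?q = "\<lambda>N. real (card (V N :: 'a Vinf set))"
  have q_pos: "?q N > 0" for N
    using card_inter_V_pos[OF Vinf.subspace_UNIV, of N, where 'a = 'a] by simp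
  have meas: "{X \<in> Gr. u \<in> X} \<in> events" for u using mem_set_in_sets sets by simp
  \<comment> \<open>Writing the cardinality as a sum of indicators turns the expected density into
    an average of membership probabilities.\<close>
  have card_eq: "real (card (X \<inter> V N)) = (\<Sum>u\<in>V N. indicator {X \<in> Gr. u \<in> X} X)" if "X \<in> Gr" for X :: "'a Vinf set" and N
  proof -
    have "(\<Sum>u\<in>V N. indicator {X \<in> Gr. u \<in> X} X) = (\<Sum>u\<in>V N. if u \<in> X then 1 else (0 :: real))"
      using that by (intro sum.cong) (auto simp: indicator_def)
    also have "\<dots> = card (X \<inter> V N)"
      by (simp add: sum.If_cases[OF finite_V] Int_commute)
    finally show ?thesis by simp
  qed
  let ?f = "\<lambda>N X. (\<Sum>u\<in>V N. indicat_real {X \<in> Gr. u \<in> X} X) / ?q N"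
  have f_eq: "?f N X = card (X \<inter> V N) / ?q N" if "X \<in> Gr" for N and X :: "'a Vinf set"
    by (simp only: card_eq[OF that])
  have le: "?p \<le> (\<integral>X. ?f N X \<partial>M)" if "v \<in> V N" for N
  proof -
    \<comment> \<open>Nonzero \<open>u\<close> give equality; the zero vector lies in every subspace
      and only increases the average.\<close>
    have "?p \<le> measure M {X \<in> Gr. u \<in> X}" if "u \<in> V N" for u
    proof (cases "u = 0")
      case True
      then have "{X \<in> Gr. u \<in> X} = space M" by (auto simp: sp Gr_def Vinf.subspace_0)
      then show ?thesis by (simp add: prob_space)
    next
      case False
      then show ?thesis using invariant_measure_mem_eq[OF inv \<open>v \<in> V N\<close> that v] by simp
    qed
    then have "(\<Sum>u\<in>(V N :: 'a Vinf set). ?p) \<le> (\<Sum>u\<in>V N. measure M {X \<in> Gr. u \<in> X})" by (rule sum_mono)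
    also have "\<dots> = (\<integral>X. (\<Sum>u\<in>V N. indicat_real {X \<in> Gr. u \<in> X} X) \<partial>M)"
      using meas by (subst Bochner_Integration.integral_sum) (auto simp: less_top[symmetric])
    finally show ?thesis using q_pos[of N] by (simp add: field_simps)
  qed
  have "(\<lambda>N. \<integral>X. ?f N X \<partial>M) \<longlonglongrightarrow> (\<integral>X. 0 \<partial>M)"
  proof (rule integral_dominated_convergence[where w = "\<lambda>_. 1"])
    show "AE X in M. (\<lambda>N. ?f N X) \<longlonglongrightarrow> 0"
      using codim AE_space
    proof eventually_elim
      case (elim X)
      then have X: "X \<in> Gr" "Vinf.subspace X" by (auto simp: sp Gr_def)
      show ?case
      proof (rule LIMSEQ_I)
        fix e :: real assume "e > 0"
        then obtain l where "inverse (real (Suc l)) < e" using reals_Archimedean by blast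
        then obtain m :: nat where m: "m > 0" "1 / m < e"
          by (intro that[of "Suc l"]) (simp_all add: inverse_eq_divide)
        have "\<forall>\<^sub>F N in sequentially. m * card (X \<inter> V N) \<le> card (V N :: 'a Vinf set)"
          by (rule infinite_codim_eventually[OF X(2)]) (use elim in blast)
        then have "\<forall>\<^sub>F N in sequentially. norm (?f N X - 0) < e"
        proof eventually_elim
          fix N assume "m * card (X \<inter> V N) \<le> card (V N :: 'a Vinf set)"
          then have "real m * card (X \<inter> V N) \<le> ?q N" by (metis of_nat_le_iff of_nat_mult)
          then have "card (X \<inter> V N) / ?q N \<le> 1 / m" using q_pos[of N] m(1) by (simp add: field_simps)
          then show "norm (?f N X - 0) < e" using m(2) by (simp only: f_eq[OF X(1)]) simp
        qed
        then show "\<exists>no. \<forall>N\<ge>no. norm (?f N X - 0) < e" by (simp add: eventually_sequentially)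
      qed
    qed
    show "AE X in M. norm (?f N X) \<le> 1" for N
      using AE_space
    proof eventually_elim
      case (elim X)
      then have "X \<in> Gr" by (simp add: sp)
      then have "norm (?f N X) = card (X \<inter> V N) / ?q N" by (simp only: f_eq) simp
      also have "\<dots> \<le> 1" using q_pos[of N] finite_V[of N, where 'a = 'a] by (simp add: card_mono)
      finally show ?case .
    qed
  qed (use meas in auto)
  moreover have "\<forall>\<^sub>F N in sequentially. ?p \<le> (\<integral>X. ?f N X \<partial>M)"
    using finite_subset_V[of "{v}"] by (rule eventually_mono) (use le in auto)
  ultimately have "?p \<le> 0"
    using tendsto_lowerbound[of "\<lambda>N. \<integral>X. ?f N X \<partial>M" 0 sequentially ?p] by simp
  then show ?thesis by (simp add: measure_le_0_iff)
qed

text \<open>\<open>V n\<close> is finite, so almost surely all its nonzero vectors are avoided at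
  once. The resulting values do not mention \<open>M\<close>, which gives uniqueness for
  \<infinity>.\<close>

lemma invariant_infinite_codim_nbhd:
  fixes M :: "'a::{field,finite} Vinf set measure"
  assumes inv: "invariant_prob_measure M" and codim: "AE X in M. \<forall>k. \<not> has_codim X k"
  shows "emeasure M (Gr_nbhd n Y) = (if Y \<inter> V n = {0} then 1 else 0)"
proof -
  from inv have sets: "sets M = sets Gr_borel" and "prob_space M"
    unfolding invariant_prob_measure_iff by auto
  interpret prob_space M by fact
  have sp: "space M = Gr" using sets_eq_imp_space_eq[OF sets] by (simp add: space_Gr_borel)
  have "AE X in M. v \<notin> X" if "v \<noteq> 0" for v
  proof (rule AE_I[where N = "{X \<in> Gr. v \<in> X}"])
    show "emeasure M {X \<in> Gr. v \<in> X} = 0"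
      using invariant_infinite_codim_measure_mem[OF inv codim that] by (simp add: emeasure_eq_measure)
  qed (use mem_set_in_sets sets sp in auto)
  then have "AE X in M. \<forall>v\<in>V n - {0}. v \<notin> X"
    by (intro AE_finite_allI) (auto simp: finite_V)
  then have AE: "AE X in M. X \<inter> V n = {0}"
    using AE_space
  proof eventually_elim
    case (elim X)
    then have "0 \<in> X" by (simp add: sp Gr_def Vinf.subspace_0)
    then show ?case using elim by auto
  qed
  show ?thesis
  proof (cases "Y \<inter> V n = {0}")
    case True
    have "AE X in M. X \<in> Gr_nbhd n Y"
      using AE AE_space by eventually_elim (simp add: True Gr_nbhd_def sp)
    then have "emeasure M (Gr_nbhd n Y) = 1"
      using Gr_nbhd_in_sets sets by (intro emeasure_eq_1_AE) auto
    then show ?thesis using True by simp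
  next
    case False
    have "AE X in M. X \<notin> Gr_nbhd n Y"
      using AE by eventually_elim (use False in \<open>auto simp: Gr_nbhd_def\<close>)
    then have "emeasure M (Gr_nbhd n Y) = 0"
      using Gr_nbhd_in_sets sets by (subst (asm) AE_iff_measurable[OF _ refl]) (auto simp: sp Gr_nbhd_def)
    then show ?thesis using False by simp
  qed
qed

lemma invariant_unique:
  fixes M1 M2 :: "'a::{field,finite} Vinf set measure"
  assumes inv: "invariant_prob_measure M1" "invariant_prob_measure M2"
    and codim: "AE X in M1. codim_is X \<kappa>" "AE X in M2. codim_is X \<kappa>"
  shows "M1 = M2"
proof (cases \<kappa>)
  case (enat k)
  then show ?thesis using invariant_unique_finite_codim[OF inv] codim by (simp add: codim_is_def)
next
  case infinity
  then have *: "AE X in M1. \<forall>k. \<not> has_codim X k" "AE X in M2. \<forall>k. \<not> has_codim X k"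
    using codim by (simp_all add: codim_is_def)
  show ?thesis
  proof (rule Gr_measure_eqI[where m = 0])
    show "emeasure M1 (Gr_nbhd n X) = emeasure M2 (Gr_nbhd n X)" for n X
      using invariant_infinite_codim_nbhd[OF inv(1) *(1)] invariant_infinite_codim_nbhd[OF inv(2) *(2)] by simp
  qed (use inv in \<open>auto simp: invariant_prob_measure_iff\<close>)
qed

section \<open>Existence: kernels of random linear maps\<close>

text \<open>The linear map that sends the \<open>i\<close>-th standard basis vector to
  \<open>x i\<close>.\<close>

definition eval_seq :: "(nat \<Rightarrow> 'a::field Vinf) \<Rightarrow> 'a Vinf \<Rightarrow> 'a Vinf" where
  "eval_seq x \<xi> = (\<Sum>i\<in>Poly_Mapping.keys \<xi>. scale (Poly_Mapping.lookup \<xi> i) (x i))"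

definition ker_seq :: "(nat \<Rightarrow> 'a::field Vinf) \<Rightarrow> 'a Vinf set" where
  "ker_seq x = {\<xi>. eval_seq x \<xi> = 0}"

lemma eval_seq_superset:
  assumes "finite S" "Poly_Mapping.keys \<xi> \<subseteq> S"
  shows "eval_seq x \<xi> = (\<Sum>i\<in>S. scale (Poly_Mapping.lookup \<xi> i) (x i))"
  unfolding eval_seq_def
  by (rule sum.mono_neutral_left) (use assms in \<open>auto simp: in_keys_iff\<close>)

lemma keys_V: "\<xi> \<in> V n \<Longrightarrow> Poly_Mapping.keys \<xi> \<subseteq> {..<n}"
  unfolding V_def subset_iff lessThan_iff mem_Collect_eq in_keys_iff by (metis not_less)

lemma eval_seq_V:
  "\<xi> \<in> V n \<Longrightarrow> eval_seq x \<xi> = (\<Sum>i<n. scale (Poly_Mapping.lookup \<xi> i) (x i))"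
  by (rule eval_seq_superset[OF finite_lessThan keys_V])

lemma linear_eval_seq: "Vector_Spaces.linear scale scale (eval_seq x)"
  unfolding linear_scale_iff
proof (intro conjI allI)
  fix \<xi> \<eta> :: "'a Vinf" and c
  let ?S = "Poly_Mapping.keys \<xi> \<union> Poly_Mapping.keys \<eta>"
  have "eval_seq x (\<xi> + \<eta>) = (\<Sum>i\<in>?S. scale (Poly_Mapping.lookup (\<xi> + \<eta>) i) (x i))"
    by (rule eval_seq_superset) (simp_all add: Poly_Mapping.keys_add)
  also have "\<dots> = (\<Sum>i\<in>?S. scale (Poly_Mapping.lookup \<xi> i) (x i)) +
      (\<Sum>i\<in>?S. scale (Poly_Mapping.lookup \<eta> i) (x i))"
    by (simp add: lookup_add Vinf.scale_left_distrib sum.distrib)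
  also have "\<dots> = eval_seq x \<xi> + eval_seq x \<eta>"
    by (simp add: eval_seq_superset[of ?S])
  finally show "eval_seq x (\<xi> + \<eta>) = eval_seq x \<xi> + eval_seq x \<eta>" .
  have "eval_seq x (scale c \<xi>) =
      (\<Sum>i\<in>Poly_Mapping.keys \<xi>. scale (Poly_Mapping.lookup (scale c \<xi>) i) (x i))"
    by (rule eval_seq_superset) (auto simp: in_keys_iff)
  then show "eval_seq x (scale c \<xi>) = scale c (eval_seq x \<xi>)"
    by (simp add: eval_seq_def Vinf.scale_sum_right)
qed

interpretation eval_seq: Vector_Spaces.linear scale scale "eval_seq x"
  by (rule linear_eval_seq)

lemma eval_seq_single: "eval_seq x (Poly_Mapping.single i 1) = x i"
  by (simp add: eval_seq_def)

lemma ker_seq_in_Gr: "ker_seq x \<in> Gr"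
  unfolding ker_seq_def Gr_def using eval_seq.subspace_kernel by blast

lemma eval_seq_in_V: "(\<And>i. x i \<in> V k) \<Longrightarrow> eval_seq x \<xi> \<in> V k"
  unfolding eval_seq_def using subspace_V[of k]
  by (intro Vinf.subspace_sum Vinf.subspace_scale) auto

lemma ker_seq_inter_V_cong:
  assumes "\<And>i. i < n \<Longrightarrow> x i = y i"
  shows "ker_seq x \<inter> V n = ker_seq y \<inter> V n"
proof -
  have "eval_seq x \<xi> = eval_seq y \<xi>" if "\<xi> \<in> V n" for \<xi>
    unfolding eval_seq_V[OF that] using assms by simp
  then show ?thesis by (auto simp: ker_seq_def)
qed

lemma scale_single_one: "scale a (Poly_Mapping.single i 1) = Poly_Mapping.single i a"
  by (rule Vinf_eqI) (simp add: lookup_single when_def)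

text \<open>The map \<open>eval_seq x\<close> identifies the quotient by its kernel with
  \<open>V k\<close>. Each unit vector of \<open>V k\<close> is the value of some standard basis
  vector, and these basis vectors form a basis modulo the kernel.\<close>

lemma has_codim_ker_seq:
  fixes x :: "nat \<Rightarrow> 'a::field Vinf"
  assumes x: "\<And>i. x i \<in> V k" and surj: "V k \<subseteq> range x"
  shows "has_codim (ker_seq x) k"
proof -
  let ?e = "\<lambda>j. Poly_Mapping.single j (1 :: 'a)"
  have "\<exists>i. x i = ?e j" if "j < k" for j
  proof -
    have "?e j \<in> V k" using that by (auto simp: V_def lookup_single when_def)
    then have "?e j \<in> range x" using surj by blast
    then show ?thesis by (auto simp: image_iff)
  qed
  then obtain idx where idx: "\<And>j. j < k \<Longrightarrow> x (idx j) = ?e j" by metis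
  let ?b = "\<lambda>j. ?e (idx j)"
  let ?B = "?b ` {..<k}"
  have eval_b: "eval_seq x (?b j) = ?e j" if "j < k" for j
    using that by (simp add: eval_seq_single idx)
  have inj: "inj_on ?b {..<k}"
  proof (rule inj_onI)
    fix i j assume "i \<in> {..<k}" "j \<in> {..<k}" "?b i = ?b j"
    then have "?e i = ?e j" using eval_b by (metis lessThan_iff)
    then have "Poly_Mapping.lookup (?e i) i = Poly_Mapping.lookup (?e j) i" by simp
    then show "i = j" by (simp add: lookup_single when_def split: if_splits)
  qed
  have eval_comb: "eval_seq x (comb ?B c) = (\<Sum>j<k. Poly_Mapping.single j (c (?b j)))" for c
  proof -
    have "comb ?B c = (\<Sum>j<k. scale (c (?b j)) (?b j))"
      by (simp add: sum.reindex[OF inj])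
    then have "eval_seq x (comb ?B c) = (\<Sum>j<k. scale (c (?b j)) (?e j))"
      by (simp add: eval_seq.sum eval_seq.scale eval_b)
    then show ?thesis by (simp only: scale_single_one)
  qed
  have "basis_modulo (ker_seq x) ?B"
    unfolding basis_modulo_finite[OF finite_imageI[OF finite_lessThan]]
  proof (intro conjI allI impI)
    fix c assume "comb ?B c \<in> ker_seq x"
    then have *: "(\<Sum>j<k. Poly_Mapping.single j (c (?b j))) = 0"
      by (simp add: ker_seq_def flip: eval_comb)
    have "c (?b i) = 0" if "i < k" for i
    proof -
      have "Poly_Mapping.lookup (\<Sum>j<k. Poly_Mapping.single j (c (?b j))) i = c (?b i)"
        using that by (simp add: lookup_sum lookup_single when_def)
      then show ?thesis unfolding * by simp
    qed
    then show "\<forall>b\<in>?B. c b = 0" by auto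
  next
    fix v
    \<comment> \<open>The coefficient at \<open>?b j\<close> has to be the \<open>j\<close>-th
      coordinate of the value at \<open>v\<close>; \<open>inv_into\<close> recovers \<open>j\<close>
      from the basis vector.\<close>
    define c where "c b = Poly_Mapping.lookup (eval_seq x v) (inv_into {..<k} ?b b)" for b
    have "c (?b j) = Poly_Mapping.lookup (eval_seq x v) j" if "j < k" for j
      using inv_into_f_f[OF inj, of j] that by (simp add: c_def)
    then have "eval_seq x (comb ?B c) = trunc k (eval_seq x v)"
      unfolding eval_comb trunc_def by (intro sum.cong) auto
    also have "\<dots> = eval_seq x v" using eval_seq_in_V[OF x] by (rule trunc_of_V)
    finally have "v - comb ?B c \<in> ker_seq x" by (simp add: ker_seq_def eval_seq.diff)
    then show "\<exists>c. v - comb ?B c \<in> ker_seq x" by (rule exI[where x = c])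
  qed
  then show ?thesis
    unfolding has_codim_def by (intro exI[of _ ?B]) (simp add: card_image[OF inj])
qed

text \<open>The linear maps from \<open>V n\<close> to \<open>V k\<close> with kernel
  \<open>Y \<inter> V n\<close>, each encoded by its values on the \<open>n\<close> basis vectors.
  Extensionality makes the set finite; the values of \<open>f\<close> from \<open>n\<close> on do
  not affect the trace on \<open>V n\<close>.\<close>

definition level_kernels :: "nat \<Rightarrow> nat \<Rightarrow> 'a::field Vinf set \<Rightarrow> (nat \<Rightarrow> 'a Vinf) set" where
  "level_kernels k n Y = {f \<in> {..<n} \<rightarrow>\<^sub>E V k. ker_seq f \<inter> V n = Y \<inter> V n}"

lemma finite_level_kernels: "finite (level_kernels k n (Y :: 'a::{field,finite} Vinf set))"
  unfolding level_kernels_def by (rule finite_subset[OF Collect_restrict finite_PiE]) (auto simp: finite_V)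

text \<open>Precomposition with \<open>g\<close> pulls the kernel back from the image of
  \<open>Y\<close> to \<open>Y\<close>, and \<open>?t\<close> is this operation on encoded maps. It
  is injective because \<open>g\<close> maps \<open>V n\<close> onto itself. The inverse of
  \<open>g\<close> supplies the opposite inequality.\<close>

lemma card_level_kernels_le:
  fixes Y :: "'a::{field,finite} Vinf set"
  assumes g: "g \<in> GLn n"
  shows "card (level_kernels k n (g ` Y)) \<le> card (level_kernels k n Y)"
proof (rule card_inj_on_le[OF _ _ finite_level_kernels])
  interpret g: Vector_Spaces.linear scale scale g by (rule GLn_D[OF g])
  let ?t = "\<lambda>f. restrict (\<lambda>i. eval_seq f (g (Poly_Mapping.single i 1))) {..<n}"
  have t: "eval_seq (?t f) \<xi> = eval_seq f (g \<xi>)" if "\<xi> \<in> V n" for f \<xi>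
  proof -
    have "\<xi> = (\<Sum>i<n. scale (Poly_Mapping.lookup \<xi> i) (Poly_Mapping.single i 1))"
      using trunc_of_V[OF that] by (simp add: trunc_def scale_single_one)
    then have "eval_seq f (g \<xi>) = eval_seq f (g (\<Sum>i<n. scale (Poly_Mapping.lookup \<xi> i) (Poly_Mapping.single i 1)))"
      by (rule arg_cong)
    then show ?thesis
      by (simp add: eval_seq_V[OF that] g.sum g.scale eval_seq.sum eval_seq.scale)
  qed
  have V_image: "g ` V n = V n" by (rule GLn_image_V[OF g])
  have inj_g: "inj g" using GLn_D(2)[OF g] by (simp add: bij_def)
  show "inj_on ?t (level_kernels k n (g ` Y))"
  proof (rule inj_onI)
    fix f1 f2 assume f: "f1 \<in> level_kernels k n (g ` Y)" "f2 \<in> level_kernels k n (g ` Y)" "?t f1 = ?t f2"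
    have "f1 i = f2 i" if "i < n" for i
    proof -
      have "Poly_Mapping.single i 1 \<in> V n" using that by (auto simp: V_def lookup_single when_def)
      then obtain \<xi> where \<xi>: "\<xi> \<in> V n" "g \<xi> = Poly_Mapping.single i 1"
        using V_image by (metis imageE)
      show ?thesis using t[OF \<xi>(1), of f1] t[OF \<xi>(1), of f2] f(3) by (simp add: \<xi>(2) eval_seq_single)
    qed
    moreover have "f1 \<in> {..<n} \<rightarrow>\<^sub>E V k" "f2 \<in> {..<n} \<rightarrow>\<^sub>E V k"
      using f(1,2) by (simp_all add: level_kernels_def)
    ultimately show "f1 = f2" by (metis PiE_ext lessThan_iff)
  qed
  show "?t ` level_kernels k n (g ` Y) \<subseteq> level_kernels k n Y"
  proof (rule image_subsetI)
    fix f assume f: "f \<in> level_kernels k n (g ` Y)"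
    then have f_V: "f i \<in> V k" if "i < n" for i
      using that by (auto simp: level_kernels_def)
    have ker: "ker_seq f \<inter> V n = g ` Y \<inter> V n" using f by (simp add: level_kernels_def)
    have g_V: "g \<xi> \<in> V n" if "\<xi> \<in> V n" for \<xi> using that V_image by blast
    have "?t f \<in> {..<n} \<rightarrow>\<^sub>E V k"
    proof (rule restrict_PiE[THEN iffD2], intro Pi_I)
      fix i assume "i \<in> {..<n}"
      then have "Poly_Mapping.single i 1 \<in> V n" by (auto simp: V_def lookup_single when_def)
      from eval_seq_V[OF g_V[OF this]] show "eval_seq f (g (Poly_Mapping.single i 1)) \<in> V k"
        using subspace_V[of k] f_V by (auto intro!: Vinf.subspace_sum Vinf.subspace_scale)
    qed
    moreover have "ker_seq (?t f) \<inter> V n = Y \<inter> V n"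
    proof (intro set_eqI)
      fix \<xi>
      have "\<xi> \<in> ker_seq (?t f) \<longleftrightarrow> \<xi> \<in> Y" if "\<xi> \<in> V n"
      proof -
        have "\<xi> \<in> ker_seq (?t f) \<longleftrightarrow> g \<xi> \<in> ker_seq f \<inter> V n"
          using g_V[OF that] by (simp add: ker_seq_def t[OF that])
        also have "\<dots> \<longleftrightarrow> \<xi> \<in> Y"
          unfolding ker using g_V[OF that] inj_g by (simp add: inj_image_mem_iff)
        finally show ?thesis .
      qed
      then show "\<xi> \<in> ker_seq (?t f) \<inter> V n \<longleftrightarrow> \<xi> \<in> Y \<inter> V n" by blast
    qed
    ultimately show "?t f \<in> level_kernels k n Y" by (simp add: level_kernels_def)
  qed
qed

lemma card_level_kernels_GLn:
  fixes Y :: "'a::{field,finite} Vinf set"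
  assumes g: "g \<in> GLn n"
  shows "card (level_kernels k n (g ` Y)) = card (level_kernels k n Y)"
  using card_level_kernels_le[OF g, of k Y] card_level_kernels_le[OF GLn_inv[OF g], of k "g ` Y"]
  by (simp add: image_inv_GLn[OF g])

section \<open>Independent uniform values on the standard basis\<close>

definition unif_seq :: "nat \<Rightarrow> (nat \<Rightarrow> 'a::field Vinf) measure" where
  "unif_seq k = PiM UNIV (\<lambda>_. uniform_count_measure (V k))"

lemma space_unif_seq: "space (unif_seq k) = {x. \<forall>i. x i \<in> V k}"
  by (auto simp: unif_seq_def space_PiM PiE_def Pi_def space_uniform_count_measure)

lemma product_prob_space_unif:
  "product_prob_space (\<lambda>_ :: nat. uniform_count_measure (V k :: 'a::{field,finite} Vinf set))"
  using zero_in_V[of k, where 'a = 'a]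
  by (intro product_prob_spaceI prob_space_uniform_count_measure finite_V) blast

lemma prob_space_unif_seq: "prob_space (unif_seq k :: (nat \<Rightarrow> 'a::{field,finite} Vinf) measure)"
proof -
  interpret product_prob_space "\<lambda>_ :: nat. uniform_count_measure (V k :: 'a Vinf set)" UNIV
    by (rule product_prob_space_unif)
  show ?thesis unfolding unif_seq_def by (rule P.prob_space_axioms)
qed

lemma unif_seq_component_in_sets: "{x \<in> space (unif_seq k). x i \<in> A} \<in> sets (unif_seq k)"
proof -
  have "{x \<in> space (unif_seq k). x i \<in> A} = {x \<in> space (unif_seq k). x i \<in> A \<inter> V k}"
    by (auto simp: space_unif_seq)
  also have "\<dots> \<in> sets (unif_seq k)"
    unfolding unif_seq_def by (rule sets_Collect_single) (auto simp: sets_uniform_count_measure)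
  finally show ?thesis .
qed

lemma unif_seq_box_in_sets: "{x \<in> space (unif_seq k). \<forall>i<n. x i \<in> A i} \<in> sets (unif_seq k)"
proof -
  have "{x \<in> space (unif_seq k). \<forall>i\<in>{..<n}. x i \<in> A i} \<in> sets (unif_seq k)"
    by (rule sets.sets_Collect_finite_All[OF unif_seq_component_in_sets finite_lessThan])
  then show ?thesis by (simp only: Ball_def lessThan_iff)
qed

lemma measure_unif_seq_box:
  assumes A: "\<And>i. i < n \<Longrightarrow> A i \<subseteq> (V k :: 'a::{field,finite} Vinf set)"
  shows "measure (unif_seq k) {x \<in> space (unif_seq k). \<forall>i<n. x i \<in> A i} =
    (\<Prod>i<n. card (A i) / card (V k :: 'a Vinf set))"
proof -
  interpret product_prob_space "\<lambda>_ :: nat. uniform_count_measure (V k :: 'a Vinf set)" UNIV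
    by (rule product_prob_space_unif)
  have "emeasure (unif_seq k) {x \<in> space (unif_seq k). \<forall>i\<in>{..<n}. x i \<in> A i} =
      (\<Prod>i<n. emeasure (uniform_count_measure (V k :: 'a Vinf set)) (A i))"
    unfolding unif_seq_def by (rule emeasure_PiM_Collect) (use A in \<open>auto simp: sets_uniform_count_measure\<close>)
  also have "\<dots> = (\<Prod>i<n. ennreal (card (A i) / card (V k :: 'a Vinf set)))"
    using A by (intro prod.cong refl emeasure_uniform_count_measure) (auto simp: finite_V)
  also have "\<dots> = ennreal (\<Prod>i<n. card (A i) / card (V k :: 'a Vinf set))"
    by (rule prod_ennreal) simp
  finally show ?thesis
    unfolding measure_def Ball_def lessThan_iff by (simp add: prod_nonneg)
qed

text \<open>The trace on \<open>V n\<close> depends only on the first \<open>n\<close> values. The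
  event is thus a disjoint union of boxes that prescribe these values, all of the same
  probability.\<close>

lemma ker_seq_event:
  fixes Y :: "'a::{field,finite} Vinf set" and k n :: nat
  defines "D \<equiv> {x \<in> space (unif_seq k). ker_seq x \<inter> V n = Y \<inter> V n}"
  shows "D \<in> sets (unif_seq k)"
    and "measure (unif_seq k) D = card (level_kernels k n Y) * (1 / card (V k :: 'a Vinf set)) ^ n"
proof -
  interpret prob_space "unif_seq k :: (nat \<Rightarrow> 'a Vinf) measure" by (rule prob_space_unif_seq)
  let ?C = "\<lambda>f. {x \<in> space (unif_seq k). \<forall>i<n. x i \<in> {f i}}"
  let ?F = "level_kernels k n Y"
  have D: "D = (\<Union>f\<in>?F. ?C f)"
  proof (intro equalityI subsetI)
    fix x assume x: "x \<in> D"
    have "ker_seq (restrict x {..<n}) \<inter> V n = ker_seq x \<inter> V n"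
      by (rule ker_seq_inter_V_cong) simp
    then have "restrict x {..<n} \<in> ?F" using x by (auto simp: D_def level_kernels_def space_unif_seq)
    moreover have "x \<in> ?C (restrict x {..<n})" using x by (simp add: D_def)
    ultimately show "x \<in> (\<Union>f\<in>?F. ?C f)" by blast
  next
    fix x assume "x \<in> (\<Union>f\<in>?F. ?C f)"
    then obtain f where f: "f \<in> ?F" "x \<in> ?C f" by blast
    then have "ker_seq x \<inter> V n = ker_seq f \<inter> V n" by (intro ker_seq_inter_V_cong) simp
    then show "x \<in> D" using f by (simp add: D_def level_kernels_def)
  qed
  have C_sets: "?C f \<in> events" for f by (rule unif_seq_box_in_sets)
  show "D \<in> events" unfolding D
    by (rule sets.finite_UN[OF finite_level_kernels]) (rule C_sets)
  have disj: "disjoint_family_on ?C ?F"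
  proof (unfold disjoint_family_on_def, intro ballI impI)
    fix f f' assume f: "f \<in> ?F" "f' \<in> ?F" "f \<noteq> f'"
    have "f \<in> {..<n} \<rightarrow>\<^sub>E V k" "f' \<in> {..<n} \<rightarrow>\<^sub>E V k"
      using f(1,2) by (simp_all add: level_kernels_def)
    then have "\<exists>i<n. f i \<noteq> f' i" using f(3) by (metis PiE_ext lessThan_iff)
    then show "?C f \<inter> ?C f' = {}" by auto
  qed
  have "prob D = (\<Sum>f\<in>?F. prob (?C f))"
    unfolding D by (rule finite_measure_finite_Union[OF finite_level_kernels _ disj])
      (rule image_subsetI, rule C_sets)
  also have "\<dots> = (\<Sum>f\<in>?F. (1 / card (V k :: 'a Vinf set)) ^ n)"
  proof (rule sum.cong[OF refl])
    fix f assume "f \<in> ?F"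
    then have "{f i} \<subseteq> V k" if "i < n" for i using that by (auto simp: level_kernels_def)
    from measure_unif_seq_box[OF this] show "prob (?C f) = (1 / card (V k :: 'a Vinf set)) ^ n"
      by simp
  qed
  finally show "prob D = card ?F * (1 / card (V k :: 'a Vinf set)) ^ n" by simp
qed

text \<open>A fixed \<open>w\<close> is missed by the first \<open>n\<close> values with probability
  \<open>((?c - 1) / ?c) ^ n\<close>, which tends to 0; there are only finitely many
  \<open>w\<close> to consider.\<close>

lemma AE_unif_seq_surj:
  "AE x in (unif_seq k :: (nat \<Rightarrow> 'a::{field,finite} Vinf) measure). V k \<subseteq> range x"
proof -
  interpret prob_space "unif_seq k :: (nat \<Rightarrow> 'a Vinf) measure" by (rule prob_space_unif_seq)
  let ?c = "real (card (V k :: 'a Vinf set))"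
  have "AE x in unif_seq k. w \<in> range x" if w: "w \<in> (V k :: 'a Vinf set)" for w
  proof (rule AE_I)
    let ?N = "{x \<in> space (unif_seq k). \<forall>i. x i \<in> V k - {w}}"
    show "{x \<in> space (unif_seq k). w \<notin> range x} \<subseteq> ?N" by (auto simp: space_unif_seq)
    show N_sets: "?N \<in> events"
      by (intro sets.sets_Collect_countable_All unif_seq_component_in_sets)
    have c: "?c > 0" using w finite_V[of k, where 'a = 'a] by (auto simp: card_gt_0_iff)
    have le: "prob ?N \<le> ((?c - 1) / ?c) ^ n" for n
    proof -
      have "prob ?N \<le> prob {x \<in> space (unif_seq k). \<forall>i<n. x i \<in> V k - {w}}"
        by (rule finite_measure_mono[OF _ unif_seq_box_in_sets]) fast
      also have "\<dots> = (\<Prod>i<n. card (V k - {w}) / ?c)" by (rule measure_unif_seq_box) auto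
      also have "real (card (V k - {w})) = ?c - 1"
        using w c finite_V[of k, where 'a = 'a] by (simp add: card_Diff_singleton of_nat_diff Suc_leI)
      finally show ?thesis by simp
    qed
    have "(\<lambda>n. ((?c - 1) / ?c) ^ n) \<longlonglongrightarrow> 0"
      by (rule LIMSEQ_power_zero) (use c in \<open>auto simp: field_simps abs_if\<close>)
    then have "prob ?N \<le> 0" by (rule LIMSEQ_le_const) (use le in auto)
    then show "emeasure (unif_seq k) ?N = 0" by (simp add: emeasure_eq_measure measure_le_0_iff)
  qed
  then have "AE x in unif_seq k. \<forall>w\<in>(V k :: 'a Vinf set). w \<in> range x"
    by (intro AE_finite_allI finite_V)
  then show ?thesis by eventually_elim blast
qed

text \<open>The mass of a neighbourhood is a count of linear maps times a factor independent of
  \<open>Y\<close>, so invariance of the measure is exactly invariance of that count.\<close>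

lemma invariant_exists_finite_codim:
  "\<exists>M :: 'a::{field,finite} Vinf set measure. invariant_prob_measure M \<and> (AE X in M. has_codim X k)"
proof (intro exI conjI)
  let ?P = "unif_seq k :: (nat \<Rightarrow> 'a Vinf) measure"
  let ?M = "distr ?P Gr_borel ker_seq"
  interpret prob_space ?P by (rule prob_space_unif_seq)
  have vimage: "ker_seq -` Gr_nbhd n Y \<inter> space ?P = {x \<in> space ?P. ker_seq x \<inter> V n = Y \<inter> V n}" for n Y
    using ker_seq_in_Gr by (auto simp: Gr_nbhd_def)
  have meas: "ker_seq \<in> measurable ?P Gr_borel"
    by (rule measurable_Gr_borelI[where m = 0]) (use ker_seq_in_Gr ker_seq_event(1) vimage in auto)
  have emeasure_M: "emeasure ?M (Gr_nbhd n Y) =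
      ennreal (card (level_kernels k n Y) * (1 / card (V k :: 'a Vinf set)) ^ n)" for n Y
    using ker_seq_event(2)[of k n Y]
    by (simp add: emeasure_distr[OF meas Gr_nbhd_in_sets] vimage emeasure_eq_measure)
  show "invariant_prob_measure ?M"
    unfolding invariant_prob_measure_iff
    by (auto simp: emeasure_M card_level_kernels_GLn prob_space_distr[OF meas])
  have "AE x in ?P. has_codim (ker_seq x) k"
    using AE_unif_seq_surj AE_space
    by eventually_elim (auto simp: space_unif_seq intro: has_codim_ker_seq)
  then show "AE X in ?M. has_codim X k"
    using codim_in_sets[of k, where 'a = 'a] by (subst AE_distr_iff[OF meas]) (simp_all add: space_Gr_borel)
qed

section \<open>Ergodicity\<close>

lemma codim_is_in_sets: "{X :: 'a::{field,finite} Vinf set. X \<in> Gr \<and> codim_is X \<kappa>} \<in> sets Gr_borel"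
proof (cases \<kappa>)
  case (enat k)
  then show ?thesis using codim_in_sets by (simp add: codim_is_def)
next
  case infinity
  have "{X :: 'a Vinf set. X \<in> Gr \<and> codim_is X \<kappa>} =
      space Gr_borel - (\<Union>k. {X. X \<in> Gr \<and> has_codim X k})"
    by (auto simp: infinity codim_is_def space_Gr_borel)
  also have "\<dots> \<in> sets Gr_borel" using codim_in_sets by (intro sets.compl_sets sets.countable_UN) auto
  finally show ?thesis .
qed

lemma codim_is_unique:
  fixes X :: "'a::{field,finite} Vinf set"
  assumes "X \<in> Gr" "codim_is X \<kappa>" "codim_is X \<kappa>'"
  shows "\<kappa> = \<kappa>'"
  using assms has_codim_unique[of X] by (auto simp: codim_is_def Gr_def split: enat.splits)

lemma UNIV_in_Gr: "UNIV \<in> Gr" and zero_in_Gr: "{0} \<in> Gr"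
  by (simp_all add: Gr_def)

lemma codim_is_UNIV: "codim_is UNIV 0"
proof -
  have "basis_modulo UNIV {}" by (simp add: basis_modulo_finite)
  then have "has_codim UNIV 0" unfolding has_codim_def by (intro exI[of _ "{}"]) simp
  then show ?thesis by (simp add: codim_is_def zero_enat_def)
qed

text \<open>Finite codimension of \<open>{0}\<close> would make \<open>card (V N)\<close> eventually
  constant, although each \<open>V (Suc m)\<close> contains a unit vector outside
  \<open>V m\<close>.\<close>

lemma codim_is_zero: "codim_is ({0} :: 'a::{field,finite} Vinf set) \<infinity>"
proof -
  have False if k: "has_codim ({0} :: 'a Vinf set) k" for k
  proof -
    have "\<forall>\<^sub>F N in sequentially. CARD('a) ^ k = card (V N :: 'a Vinf set)"
      using eventually_card_codim[OF Vinf.subspace_single_0 k] by (simp add: Int_absorb2)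
    then obtain m where "\<And>N. N \<ge> m \<Longrightarrow> card (V N :: 'a Vinf set) = CARD('a) ^ k"
      unfolding eventually_sequentially by metis
    then have "card (V m :: 'a Vinf set) = card (V (Suc m) :: 'a Vinf set)" by simp
    then have eq: "V m = (V (Suc m) :: 'a Vinf set)"
      by (intro card_subset_eq finite_V V_mono) simp_all
    have "Poly_Mapping.single m 1 \<in> (V (Suc m) :: 'a Vinf set)"
      by (auto simp: V_def lookup_single when_def)
    then have "Poly_Mapping.single m 1 \<in> (V m :: 'a Vinf set)" using eq by simp
    then have "Poly_Mapping.lookup (Poly_Mapping.single m (1 :: 'a)) m = 0"
      unfolding V_def by blast
    then show False by simp
  qed
  then show ?thesis by (auto simp: codim_is_def)
qed

section \<open>Dirac masses at the fixed points of the action\<close>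

lemma invariant_return:
  fixes X :: "'a::{field,finite} Vinf set"
  assumes X: "X \<in> Gr" and fixed: "\<And>n g. g \<in> GLn n \<Longrightarrow> g ` X = X"
  shows "invariant_prob_measure (return Gr_borel X)"
  unfolding invariant_prob_measure_iff
proof (intro conjI allI ballI)
  show "prob_space (return Gr_borel X)"
    by (rule prob_space_return) (simp add: space_Gr_borel X)
  fix n Y and g :: "'a Vinf \<Rightarrow> 'a Vinf" assume g: "g \<in> GLn n"
  have "X \<in> (\<lambda>X. g ` X) -` Gr_nbhd n (g ` Y) \<inter> Gr \<longleftrightarrow> X \<in> Gr_nbhd n Y"
    by (simp only: vimage_GLn_nbhd[OF g])
  then have "X \<in> Gr_nbhd n (g ` Y) \<longleftrightarrow> X \<in> Gr_nbhd n Y"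
    using X by (simp add: fixed[OF g])
  then show "emeasure (return Gr_borel X) (Gr_nbhd n (g ` Y)) = emeasure (return Gr_borel X) (Gr_nbhd n Y)"
    by (simp add: emeasure_return Gr_nbhd_in_sets indicator_def)
qed simp

lemma AE_return_codim_is:
  fixes X :: "'a::{field,finite} Vinf set"
  assumes "X \<in> Gr" "codim_is X \<kappa>"
  shows "AE Y in return Gr_borel X. codim_is Y \<kappa>"
  using assms codim_is_in_sets[of \<kappa>, where 'a = 'a]
  by (subst AE_return) (simp_all add: space_Gr_borel pred_def)

lemma invariant_return_UNIV: "invariant_prob_measure (return Gr_borel (UNIV :: 'a::{field,finite} Vinf set))"
proof (rule invariant_return[OF UNIV_in_Gr])
  show "g ` UNIV = UNIV" if "g \<in> GLn n" for g :: "'a Vinf \<Rightarrow> 'a Vinf" and n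
    using GLn_D(2)[OF that] by (simp add: bij_def)
qed

lemma invariant_return_zero: "invariant_prob_measure (return Gr_borel ({0} :: 'a::{field,finite} Vinf set))"
proof (rule invariant_return[OF zero_in_Gr])
  show "g ` {0} = {0}" if "g \<in> GLn n" for g :: "'a Vinf \<Rightarrow> 'a Vinf" and n
    using GLn_D(4)[OF that, of 0] by (simp add: trunc_of_V)
qed

lemma invariant_exists:
  "\<exists>M :: 'a::{field,finite} Vinf set measure. invariant_prob_measure M \<and> (AE X in M. codim_is X \<kappa>)"
proof (cases \<kappa>)
  case (enat k)
  then show ?thesis using invariant_exists_finite_codim[of k] by (simp add: codim_is_def)
next
  case infinity
  then show ?thesis
    using invariant_return_zero AE_return_codim_is[OF zero_in_Gr codim_is_zero] by blast
qed

text \<open>There are only countably many finite codimensions. If none of them has probability 1,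
  all have probability 0, and so has their union; the codimension is then almost surely
  infinite.\<close>

lemma ergodic_imp_codim_is:
  fixes M :: "'a::{field,finite} Vinf set measure"
  assumes erg: "ergodic_measure M"
  shows "\<exists>\<kappa>. AE X in M. codim_is X \<kappa>"
proof -
  from erg have inv: "invariant_prob_measure M" by (simp add: ergodic_measure_def)
  then have sets: "sets M = sets Gr_borel" and "prob_space M"
    unfolding invariant_prob_measure_iff by auto
  interpret prob_space M by fact
  have sp: "space M = Gr" using sets_eq_imp_space_eq[OF sets] by (simp add: space_Gr_borel)
  let ?A = "\<lambda>k. {X :: 'a Vinf set. X \<in> Gr \<and> has_codim X k}"
  have A_sets: "?A k \<in> events" for k using codim_in_sets sets by simp
  have sub: "(\<lambda>X. g ` X) ` ?A k \<subseteq> ?A k" if "g \<in> GLn n" for g n k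
    using has_codim_GLn_image[OF that] subspace_GLn_image[OF that] by (auto simp: Gr_def)
  \<comment> \<open>Ergodicity speaks of sets equal to their image, so the inclusion already proved
    is applied to the inverse as well.\<close>
  have fixed: "(\<lambda>X. g ` X) ` ?A k = ?A k" if g: "g \<in> GLn n" for g n k
  proof
    show "?A k \<subseteq> (\<lambda>X. g ` X) ` ?A k"
    proof
      fix X assume "X \<in> ?A k"
      then have "inv g ` X \<in> ?A k" using sub[OF GLn_inv[OF g], of k] by blast
      then show "X \<in> (\<lambda>X. g ` X) ` ?A k"
        by (rule image_eqI[rotated]) (simp only: image_inv_GLn[OF g])
    qed
  qed (rule sub[OF g])
  have cases: "emeasure M (?A k) = 0 \<or> emeasure M (?A k) = 1" for k
  proof -
    have "\<forall>g\<in>GLinf. (\<lambda>X. g ` X) ` ?A k = ?A k"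
    proof (rule ballI)
      fix g :: "'a Vinf \<Rightarrow> 'a Vinf" assume "g \<in> GLinf"
      then obtain n where "g \<in> GLn n" unfolding GLinf_def by (rule UN_E)
      then show "(\<lambda>X. g ` X) ` ?A k = ?A k" by (rule fixed)
    qed
    with erg A_sets[of k] show ?thesis
      unfolding ergodic_measure_def by (elim conjE) (drule bspec, assumption, drule mp, assumption)
  qed
  show ?thesis
  proof (cases "\<exists>k. emeasure M (?A k) = 1")
    case True
    then obtain k where "emeasure M (?A k) = 1" by blast
    then have "AE X in M. X \<in> ?A k"
      using A_sets[of k] by (subst AE_in_set_eq_1) (simp_all add: emeasure_eq_measure)
    then have "AE X in M. codim_is X (enat k)"
      by eventually_elim (simp add: codim_is_def)
    then show ?thesis by (rule exI[of _ "enat k"])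
  next
    case False
    then have "emeasure M (?A k) = 0" for k using cases by blast
    then have "AE X in M. X \<notin> ?A k" for k
      using A_sets[of k] by (intro AE_not_in) (simp add: null_sets_def)
    then have "AE X in M. \<forall>k. X \<notin> ?A k" unfolding AE_all_countable by (rule allI)
    then have "AE X in M. codim_is X \<infinity>"
      using AE_space by eventually_elim (simp add: codim_is_def sp)
    then show ?thesis by (rule exI[of _ \<infinity>])
  qed
qed

text \<open>Conditioning on an invariant event of positive measure does not leave the class characterised
  by \<open>invariant_unique\<close>, so it does not change the measure.\<close>

lemma codim_is_imp_ergodic:
  fixes M :: "'a::{field,finite} Vinf set measure"
  assumes inv: "invariant_prob_measure M" and codim: "AE X in M. codim_is X \<kappa>"
  shows "ergodic_measure M"
  unfolding ergodic_measure_def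
proof (intro conjI ballI impI)
  show "invariant_prob_measure M" by (rule inv)
  from inv have sets: "sets M = sets Gr_borel" and "prob_space M"
    unfolding invariant_prob_measure_iff by auto
  interpret prob_space M by fact
  have sp: "space M = Gr" using sets_eq_imp_space_eq[OF sets] by (simp add: space_Gr_borel)
  fix A assume A: "A \<in> events" and A_inv: "\<forall>g\<in>GLinf. (\<lambda>X. g ` X) ` A = A"
  show "emeasure M A = 0 \<or> emeasure M A = 1"
  proof (rule disjCI)
    assume ne1: "emeasure M A \<noteq> 1"
    show "emeasure M A = 0"
    proof (rule ccontr)
      assume ne0: "emeasure M A \<noteq> 0"
      let ?M = "uniform_measure M A"
      have "invariant_prob_measure ?M"
        unfolding invariant_prob_measure_iff
      proof (intro conjI allI ballI)
        show "prob_space ?M" using ne0 by (intro prob_space_uniform_measure) auto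
        fix n Y and g :: "'a Vinf \<Rightarrow> 'a Vinf" assume g: "g \<in> GLn n"
        then have gA: "(\<lambda>X. g ` X) ` A = A" using A_inv by (auto simp: GLinf_def)
        \<comment> \<open>Injectivity on vectors makes the action on subspaces injective, which
          upgrades invariance of \<open>A\<close> as a set to the pointwise equivalence used for the
          preimage.\<close>
        have "inj g" using GLn_D(2)[OF g] by (simp add: bij_def)
        then have "g ` X \<in> A \<longleftrightarrow> X \<in> A" for X
          using gA by (metis (no_types, lifting) image_iff inj_image_eq_iff)
        then have vimage: "(\<lambda>X. g ` X) -` (A \<inter> Gr_nbhd n (g ` Y)) \<inter> space M = A \<inter> Gr_nbhd n Y"
          using vimage_GLn_nbhd[OF g, of Y] unfolding sp by blast
        have distr: "distr M Gr_borel (\<lambda>X. g ` X) = M"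
          using inv g unfolding invariant_prob_measure_def GLinf_def by auto
        have meas: "(\<lambda>X. g ` X) \<in> measurable M Gr_borel"
          using measurable_GLn[OF g] sets by (simp cong: measurable_cong_sets)
        have "emeasure (distr M Gr_borel (\<lambda>X. g ` X)) (A \<inter> Gr_nbhd n (g ` Y)) = emeasure M (A \<inter> Gr_nbhd n Y)"
          using A sets Gr_nbhd_in_sets[of n "g ` Y"]
          by (subst emeasure_distr[OF meas]) (simp_all only: vimage sets.Int)
        then have "emeasure M (A \<inter> Gr_nbhd n (g ` Y)) = emeasure M (A \<inter> Gr_nbhd n Y)"
          unfolding distr .
        then show "emeasure ?M (Gr_nbhd n (g ` Y)) = emeasure ?M (Gr_nbhd n Y)"
          using A by (simp add: sets Gr_nbhd_in_sets)
      qed (simp add: sets)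
      moreover have "AE X in ?M. codim_is X \<kappa>"
        using codim by (intro AE_uniform_measureI[OF A]) auto
      \<comment> \<open>The conditional measure gives \<open>A\<close> mass 1, so the equality
        contradicts \<open>ne1\<close>.\<close>
      ultimately have "?M = M" using invariant_unique[OF _ inv _ codim] by blast
      moreover have "emeasure ?M A = 1"
        using ne0 by (intro emeasure_uniform_measure_1) auto
      ultimately show False using ne1 by simp
    qed
  qed
qed

theorem corollary5p3:
  shows "\<exists>\<mu> :: enat \<Rightarrow> 'a::{field,finite} Vinf set measure.
           bij_betw \<mu> UNIV {M. ergodic_measure M} \<and>
           \<mu> 0 = return Gr_borel (UNIV :: 'a Vinf set) \<and>
           \<mu> \<infinity> = return Gr_borel ({0} :: 'a Vinf set) \<and>
           (\<forall>\<kappa>::nat. 0 < \<kappa> \<longrightarrow>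
              {X :: 'a Vinf set. X \<in> Gr \<and> has_codim X \<kappa>} \<in> sets Gr_borel \<and>
              emeasure (\<mu> (enat \<kappa>)) {X. X \<in> Gr \<and> has_codim X \<kappa>} = 1)"
proof -
  \<comment> \<open>An arbitrary choice of invariant measures suffices: by uniqueness each one is
    determined by its codimension, so the values at 0 and \<infinity> can be identified with Dirac
    masses afterwards.\<close>
  obtain \<mu> :: "enat \<Rightarrow> 'a Vinf set measure" where
    inv: "\<And>\<kappa>. invariant_prob_measure (\<mu> \<kappa>)" and codim: "\<And>\<kappa>. AE X in \<mu> \<kappa>. codim_is X \<kappa>"
    using invariant_exists by metis
  have eq: "\<mu> \<kappa> = M" if "invariant_prob_measure M" "AE X in M. codim_is X \<kappa>" for \<kappa> M
    by (rule invariant_unique[OF inv that(1) codim that(2)])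
  have sp: "space (\<mu> \<kappa>) = Gr" and ps: "prob_space (\<mu> \<kappa>)" and sets: "sets (\<mu> \<kappa>) = sets Gr_borel" for \<kappa>
    using inv[of \<kappa>] sets_eq_imp_space_eq[of "\<mu> \<kappa>" Gr_borel]
    by (auto simp: invariant_prob_measure_iff space_Gr_borel)
  have "inj \<mu>"
  proof (rule injI)
    fix \<kappa> \<kappa>' assume same: "\<mu> \<kappa> = \<mu> \<kappa>'"
    interpret prob_space "\<mu> \<kappa>" by (rule ps)
    have "AE X in \<mu> \<kappa>. codim_is X \<kappa>'" unfolding same by (rule codim)
    \<comment> \<open>The conclusion no longer depends on \<open>X\<close>, and a statement that
      holds almost surely on a probability space cannot be identically false.\<close>
    with codim[of \<kappa>] AE_space have "AE X in \<mu> \<kappa>. \<kappa> = \<kappa>'"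
      by eventually_elim (simp add: sp codim_is_unique)
    then show "\<kappa> = \<kappa>'" by simp
  qed
  moreover have "range \<mu> = {M. ergodic_measure M}"
  proof (intro equalityI subsetI)
    fix M :: "'a Vinf set measure" assume "M \<in> {M. ergodic_measure M}"
    then have M: "ergodic_measure M" by simp
    obtain \<kappa> where "AE X in M. codim_is X \<kappa>" using ergodic_imp_codim_is[OF M] ..
    then have "\<mu> \<kappa> = M" using M by (intro eq) (simp_all add: ergodic_measure_def)
    then show "M \<in> range \<mu>" by blast
  qed (use codim_is_imp_ergodic[OF inv codim] in auto)
  ultimately have "bij_betw \<mu> UNIV {M. ergodic_measure M}" by (simp add: bij_betw_def)
  moreover have "\<mu> 0 = return Gr_borel UNIV"
    by (rule eq[OF invariant_return_UNIV AE_return_codim_is[OF UNIV_in_Gr codim_is_UNIV]])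
  moreover have "\<mu> \<infinity> = return Gr_borel {0}"
    by (rule eq[OF invariant_return_zero AE_return_codim_is[OF zero_in_Gr codim_is_zero]])
  moreover have "emeasure (\<mu> (enat k)) {X. X \<in> Gr \<and> has_codim X k} = 1" for k
  proof -
    interpret prob_space "\<mu> (enat k)" by (rule ps)
    have "AE X in \<mu> (enat k). X \<in> {X. X \<in> Gr \<and> has_codim X k}"
      using codim[of "enat k"] AE_space by eventually_elim (simp add: sp codim_is_def)
    then show ?thesis using codim_in_sets[of k, where 'a = 'a] sets by (intro emeasure_eq_1_AE) auto
  qed
  ultimately show ?thesis using codim_in_sets[where 'a = 'a] by (intro exI[of _ \<mu>]) simp
qed

end
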